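(* Let $(k_n)_{n=1}^\infty$ be positive integers, $\mathcal{F}=\{(\mathcal{X}_{n,i},K_{n,i},\pi_{n,i}):1\le i\le k_n,n\ge1\}$ a family of irreducible Markov chains on countable state spaces and $\mathcal{P}=\{p_{n,i}:1\le i\le k_n,n\ge1\}$ a triangular array of positive reals. For $n\ge1$, $1\le i\le k_n$, let $\mu_{n,i}$ be a probability on $\mathcal{X}_{n,i}$, $\mu_n=\mu_{n,1}\times\cdots\times\mu_{n,k_n}$, $q_n=p_{n,1}+\cdots+p_{n,k_n}$, and set $$F_n(t)=\frac{\sum_{i=1}^{k_n}d^{(c)}_{n,i,H}(\mu_{n,i},p_{n,i}t/q_n)^2}{1-\max_{1\le i\le k_n}d^{(c)}_{n,i,H}(\mu_{n,i},p_{n,i}t/q_n)^2},\qquad G_n(t)=\max_{1\le i\le k_n}d^{(c)}_{n,i,H}(\mu_{n,i},p_{n,i}t/q_n),$$ where $1/0:=\infty$. Then the family $\mathcal{F}^{\mathcal{P}}_c$ with initial distributions $(\mu_n)_{n=1}^\infty$ has: (1) a cutoff in the Hellinger distance with cutoff time $t_n$ if and only if $$\lim_{n\to\infty}F_n(at_n)=\begin{cases}0&\text{for }a>1,\\ \infty&\text{for }0<a<1;\end{cases}$$ (2) a $(t_n,b_n)$ cutoff in the Hellinger distance if and only if $t_n>0$, $b_n>0$, $b_n=o(t_n)$ and $$\lim_{c\to\infty}\limsup_{n\to\infty}F_n(t_n+cb_n)=0,\qquad\lim_{c\to-\infty}\liminf_{n\to\infty}F_n(t_n+cb_n)=\infty.$$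 In particular, when $\sup_nk_n<\infty$, the equivalences in (1) and (2) remain true when $F_n$ and $\infty$ are replaced with $G_n$ and $1$ respectively.
   Context: For a chain $(\mathcal{X},K,\pi)$ (countable $\mathcal{X}$, irreducible stochastic $K$, stationary distribution $\pi$) let $H_t=e^{-t(I-K)}$, and for an initial distribution $\mu$ let $d^{(c)}_H(\mu,t)=\|\mu H_t-\pi\|_H$, where $\|\mu-\nu\|_H=\big(\frac12\sum_y(\sqrt{\mu(y)}-\sqrt{\nu(y)})^2\big)^{1/2}$. $d^{(c)}_{n,i,H}$ is this distance for $(\mathcal{X}_{n,i},e^{-t(I-K_{n,i})},\pi_{n,i})$. $\mathcal{F}^{\mathcal{P}}=(\mathcal{X}_n,K_n,\pi_n)_{n=1}^\infty$, where $\mathcal{X}_n=\prod_{i=1}^{k_n}\mathcal{X}_{n,i}$, $\pi_n=\pi_{n,1}\times\cdots\times\pi_{n,k_n}$ and $K_n=\sum_{i=1}^{k_n}\frac{p_{n,i}}{q_n}\,I\otimes\cdots\otimes K_{n,i}\otimes\cdots\otimes I$ ($K_{n,i}$ in the $i$th slot, identities elsewhere). $\mathcal{F}^{\mathcal{P}}_c=(\mathcal{X}_n,e^{-t(I-K_n)},\pi_n)_{n=1}^\infty$, and $d^{(c)}_{n,H}(\mu_n,t)$ is its Hellinger distance. The family $\mathcal{F}^{\mathcal{P}}_c$ with initial distributions $(\mu_n)$ has a cutoff in the Hellinger distance with cutoff time $t_n>0$ if $d^{(c)}_{n,H}(\mu_n,at_n)\to0$ for all $a>1$ and $\to1$ for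 all $a\in(0,1)$. It has a $(t_n,b_n)$ cutoff if $t_n>0$, $b_n>0$, $b_n=o(t_n)$ and $\lim_{c\to\infty}\limsup_nd^{(c)}_{n,H}(\mu_n,t_n+cb_n)=0$, $\lim_{c\to-\infty}\liminf_nd^{(c)}_{n,H}(\mu_n,t_n+cb_n)=1$. *)

theory Defs
  imports "HOL-Analysis.Analysis" "HOL-Library.Landau_Symbols"
begin

text \<open>
  Matrices indexed by a set \<open>S\<close> are functions \<open>'a \<Rightarrow> 'a \<Rightarrow> real\<close>, and only their values on
  \<open>S \<times> S\<close> matter.  Likewise measures on \<open>S\<close> are functions \<open>'a \<Rightarrow> real\<close>, read as row vectors.
\<close>

definition id_mat :: "'a \<Rightarrow> 'a \<Rightarrow> real" where
  "id_mat x y = of_bool (x = y)"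

definition mat_mult ::
  "'a set \<Rightarrow> ('a \<Rightarrow> 'a \<Rightarrow> real) \<Rightarrow> ('a \<Rightarrow> 'a \<Rightarrow> real) \<Rightarrow> 'a \<Rightarrow> 'a \<Rightarrow> real" where
  "mat_mult S A B x y = (\<Sum>\<^sub>\<infinity>z\<in>S. A x z * B z y)"

primrec mat_pow :: "'a set \<Rightarrow> ('a \<Rightarrow> 'a \<Rightarrow> real) \<Rightarrow> nat \<Rightarrow> 'a \<Rightarrow> 'a \<Rightarrow> real" where
  "mat_pow S A 0 = id_mat"
| "mat_pow S A (Suc m) = mat_mult S A (mat_pow S A m)"

definition mat_exp :: "'a set \<Rightarrow> ('a \<Rightarrow> 'a \<Rightarrow> real) \<Rightarrow> 'a \<Rightarrow> 'a \<Rightarrow> real" where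
  "mat_exp S A x y = (\<Sum>m. mat_pow S A m x y / fact m)"

definition vec_mult :: "'a set \<Rightarrow> ('a \<Rightarrow> real) \<Rightarrow> ('a \<Rightarrow> 'a \<Rightarrow> real) \<Rightarrow> 'a \<Rightarrow> real" where
  "vec_mult S \<mu> A y = (\<Sum>\<^sub>\<infinity>x\<in>S. \<mu> x * A x y)"

definition probability_on :: "'a set \<Rightarrow> ('a \<Rightarrow> real) \<Rightarrow> bool" where
  "probability_on S \<mu> \<longleftrightarrow> (\<forall>x\<in>S. 0 \<le> \<mu> x) \<and> (\<mu> has_sum 1) S"

definition stochastic :: "'a set \<Rightarrow> ('a \<Rightarrow> 'a \<Rightarrow> real) \<Rightarrow> bool" where
  "stochastic S K \<longleftrightarrow> (\<forall>x\<in>S. probability_on S (K x))"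

definition irreducible_chain :: "'a set \<Rightarrow> ('a \<Rightarrow> 'a \<Rightarrow> real) \<Rightarrow> bool" where
  "irreducible_chain S K \<longleftrightarrow> (\<forall>x\<in>S. \<forall>y\<in>S. \<exists>m. 0 < mat_pow S K m x y)"

definition stationary :: "'a set \<Rightarrow> ('a \<Rightarrow> 'a \<Rightarrow> real) \<Rightarrow> ('a \<Rightarrow> real) \<Rightarrow> bool" where
  "stationary S K \<pi> \<longleftrightarrow> probability_on S \<pi> \<and> (\<forall>y\<in>S. vec_mult S \<pi> K y = \<pi> y)"

definition irreducible_markov_chain ::
  "'a set \<Rightarrow> ('a \<Rightarrow> 'a \<Rightarrow> real) \<Rightarrow> ('a \<Rightarrow> real) \<Rightarrow> bool" where
  "irreducible_markov_chain S K \<pi> \<longleftrightarrow>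
     countable S \<and> stochastic S K \<and> irreducible_chain S K \<and> stationary S K \<pi>"

definition heat_kernel :: "'a set \<Rightarrow> ('a \<Rightarrow> 'a \<Rightarrow> real) \<Rightarrow> real \<Rightarrow> 'a \<Rightarrow> 'a \<Rightarrow> real" where
  "heat_kernel S K t = mat_exp S (\<lambda>x y. - t * (id_mat x y - K x y))"

definition hellinger :: "'a set \<Rightarrow> ('a \<Rightarrow> real) \<Rightarrow> ('a \<Rightarrow> real) \<Rightarrow> real" where
  "hellinger S \<mu> \<nu> = sqrt (1 / 2 * (\<Sum>\<^sub>\<infinity>y\<in>S. (sqrt (\<mu> y) - sqrt (\<nu> y))\<^sup>2))"

definition hellinger_dist ::
  "'a set \<Rightarrow> ('a \<Rightarrow> 'a \<Rightarrow> real) \<Rightarrow> ('a \<Rightarrow> real) \<Rightarrow> ('a \<Rightarrow> real) \<Rightarrow> real \<Rightarrow> real" where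
  "hellinger_dist S K \<pi> \<mu> t = hellinger S (vec_mult S \<mu> (heat_kernel S K t)) \<pi>"

text \<open>
  The product of the state spaces \<open>X i\<close>, \<open>i \<in> I\<close>, is \<open>Pi\<^sub>E I X\<close>, the set of functions that are
  \<open>undefined\<close> outside \<open>I\<close>.
\<close>

definition product_measure :: "'i set \<Rightarrow> ('i \<Rightarrow> 'a \<Rightarrow> real) \<Rightarrow> ('i \<Rightarrow> 'a) \<Rightarrow> real" where
  "product_measure I \<mu> x = (\<Prod>i\<in>I. \<mu> i (x i))"

definition tensor ::
  "'i set \<Rightarrow> ('i \<Rightarrow> 'a \<Rightarrow> 'a \<Rightarrow> real) \<Rightarrow> ('i \<Rightarrow> 'a) \<Rightarrow> ('i \<Rightarrow> 'a) \<Rightarrow> real" where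
  "tensor I A x y = (\<Prod>i\<in>I. A i (x i) (y i))"

definition product_kernel ::
  "'i set \<Rightarrow> ('i \<Rightarrow> real) \<Rightarrow> ('i \<Rightarrow> 'a \<Rightarrow> 'a \<Rightarrow> real) \<Rightarrow> ('i \<Rightarrow> 'a) \<Rightarrow> ('i \<Rightarrow> 'a) \<Rightarrow> real" where
  "product_kernel I p K x y =
     (\<Sum>i\<in>I. p i / sum p I * tensor I ((\<lambda>_. id_mat)(i := K i)) x y)"

text \<open>
  Families are indexed by \<open>n \<ge> 1\<close>; the value at \<open>n = 0\<close> is ignored.
\<close>

definition hellinger_cutoff ::
  "(nat \<Rightarrow> 'a set) \<Rightarrow> (nat \<Rightarrow> 'a \<Rightarrow> 'a \<Rightarrow> real) \<Rightarrow> (nat \<Rightarrow> 'a \<Rightarrow> real) \<Rightarrow> (nat \<Rightarrow> 'a \<Rightarrow> real) \<Rightarrow>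
   (nat \<Rightarrow> real) \<Rightarrow> bool" where
  "hellinger_cutoff S K \<pi> \<mu> t \<longleftrightarrow>
     (\<forall>n\<ge>1. 0 < t n) \<and>
     (\<forall>a>1. (\<lambda>n. hellinger_dist (S n) (K n) (\<pi> n) (\<mu> n) (a * t n)) \<longlonglongrightarrow> 0) \<and>
     (\<forall>a. 0 < a \<and> a < 1 \<longrightarrow>
        (\<lambda>n. hellinger_dist (S n) (K n) (\<pi> n) (\<mu> n) (a * t n)) \<longlonglongrightarrow> 1)"

text \<open>
  In the next definition \<open>t n + c * b n\<close> may be negative, but for every fixed \<open>c\<close> this happens
  for finitely many \<open>n\<close> only, because \<open>b \<in> o(t)\<close>.
\<close>

definition hellinger_window_cutoff ::
  "(nat \<Rightarrow> 'a set) \<Rightarrow> (nat \<Rightarrow> 'a \<Rightarrow> 'a \<Rightarrow> real) \<Rightarrow> (nat \<Rightarrow> 'a \<Rightarrow> real) \<Rightarrow> (nat \<Rightarrow> 'a \<Rightarrow> real) \<Rightarrow>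
   (nat \<Rightarrow> real) \<Rightarrow> (nat \<Rightarrow> real) \<Rightarrow> bool" where
  "hellinger_window_cutoff S K \<pi> \<mu> t b \<longleftrightarrow>
     (\<forall>n\<ge>1. 0 < t n) \<and> (\<forall>n\<ge>1. 0 < b n) \<and> b \<in> o(t) \<and>
     ((\<lambda>c. limsup (\<lambda>n. ereal (hellinger_dist (S n) (K n) (\<pi> n) (\<mu> n) (t n + c * b n))))
        \<longlongrightarrow> 0) at_top \<and>
     ((\<lambda>c. liminf (\<lambda>n. ereal (hellinger_dist (S n) (K n) (\<pi> n) (\<mu> n) (t n + c * b n))))
        \<longlongrightarrow> 1) at_bot"

text \<open>
  \<open>coord_dist k X K \<pi> p \<mu> n t i\<close> is the Hellinger distance of the \<open>i\<close>-th coordinate of the \<open>n\<close>-th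
  product chain when the product chain is run up to time \<open>t\<close>.
\<close>

definition coord_dist ::
  "(nat \<Rightarrow> nat) \<Rightarrow> (nat \<Rightarrow> nat \<Rightarrow> 'a set) \<Rightarrow> (nat \<Rightarrow> nat \<Rightarrow> 'a \<Rightarrow> 'a \<Rightarrow> real) \<Rightarrow>
   (nat \<Rightarrow> nat \<Rightarrow> 'a \<Rightarrow> real) \<Rightarrow> (nat \<Rightarrow> nat \<Rightarrow> real) \<Rightarrow> (nat \<Rightarrow> nat \<Rightarrow> 'a \<Rightarrow> real) \<Rightarrow>
   nat \<Rightarrow> real \<Rightarrow> nat \<Rightarrow> real" where
  "coord_dist k X K \<pi> p \<mu> n t i =
     hellinger_dist (X n i) (K n i) (\<pi> n i) (\<mu> n i) (p n i * t / (\<Sum>j=1..k n. p n j))"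

text \<open>
  If the maximum below is \<open>1\<close>, the numerator is at least \<open>1\<close> and the \<^typ>\<open>ereal\<close> quotient by \<open>0\<close>
  is \<open>\<infinity>\<close>.
\<close>

definition F_fun ::
  "(nat \<Rightarrow> nat) \<Rightarrow> (nat \<Rightarrow> nat \<Rightarrow> 'a set) \<Rightarrow> (nat \<Rightarrow> nat \<Rightarrow> 'a \<Rightarrow> 'a \<Rightarrow> real) \<Rightarrow>
   (nat \<Rightarrow> nat \<Rightarrow> 'a \<Rightarrow> real) \<Rightarrow> (nat \<Rightarrow> nat \<Rightarrow> real) \<Rightarrow> (nat \<Rightarrow> nat \<Rightarrow> 'a \<Rightarrow> real) \<Rightarrow>
   nat \<Rightarrow> real \<Rightarrow> ereal" where
  "F_fun k X K \<pi> p \<mu> n t =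
     ereal (\<Sum>i=1..k n. (coord_dist k X K \<pi> p \<mu> n t i)\<^sup>2) /
     ereal (1 - Max ((\<lambda>i. (coord_dist k X K \<pi> p \<mu> n t i)\<^sup>2) ` {1..k n}))"

definition G_fun ::
  "(nat \<Rightarrow> nat) \<Rightarrow> (nat \<Rightarrow> nat \<Rightarrow> 'a set) \<Rightarrow> (nat \<Rightarrow> nat \<Rightarrow> 'a \<Rightarrow> 'a \<Rightarrow> real) \<Rightarrow>
   (nat \<Rightarrow> nat \<Rightarrow> 'a \<Rightarrow> real) \<Rightarrow> (nat \<Rightarrow> nat \<Rightarrow> real) \<Rightarrow> (nat \<Rightarrow> nat \<Rightarrow> 'a \<Rightarrow> real) \<Rightarrow>
   nat \<Rightarrow> real \<Rightarrow> real" where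
  "G_fun k X K \<pi> p \<mu> n t = Max (coord_dist k X K \<pi> p \<mu> n t ` {1..k n})"

end

theory Submission
  imports Defs
begin

text \<open>
  Run for time \<open>t\<close>, the product chain moves its coordinates independently, the \<open>i\<close>-th one for time
  \<open>p i * t / q\<close>.  A product initial law therefore stays a product, and the Hellinger affinity
  \<open>1 - d\<^sup>2 = \<Sum>y. sqrt (\<mu> y * \<nu> y)\<close> is multiplicative over products.  With \<open>D\<close> the distance of the
  product chain and \<open>d i\<close> those of its coordinates this gives
  \<open>1 - D\<^sup>2 = (\<Prod>i. 1 - (d i)\<^sup>2)\<close> (lemma \<open>hellinger_dist_product\<close>).

  What remains is elementary.  Let \<open>s\<close> and \<open>m\<close> be the sum and the maximum of the \<open>(d i)\<^sup>2\<close>.  From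
  \<open>exp (- x / (1 - m)) \<le> 1 - x \<le> exp (- x)\<close> for \<open>0 \<le> x \<le> m\<close> the ratio \<open>F = s / (1 - m)\<close>
  satisfies \<open>D\<^sup>2 \<le> 1 - exp (- F)\<close> and \<open>F \<le> D\<^sup>2 / (1 - D\<^sup>2)\<^sup>2\<close>.  Hence \<open>F\<close> is small iff \<open>D\<close> is small, and
  \<open>F\<close> is large iff \<open>D\<close> is close to 1, uniformly in the chain and in time.  If there are at most
  \<open>N\<close> coordinates, the maximum \<open>G\<close> of the \<open>d i\<close> satisfies \<open>G \<le> D\<close> and
  \<open>1 - D\<^sup>2 \<ge> (1 - G\<^sup>2) ^ N\<close>, so \<open>G\<close> can replace \<open>D\<close> too.  Such a uniform comparison
  (\<open>limit_transfer\<close>) carries every limit in the two definitions of cutoff from one function to the other.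

  Matrix exponentials are handled entry by entry as formal power series in time.  The coefficients
  of \<open>exp (t A)\<close> are determined by the constant term and by the equation
  \<open>(exp (t A))' = A exp (t A)\<close>; so an identity between exponentials follows once its other side, a
  product of formal power series, is seen to satisfy the same equation.  This replaces multinomial
  expansions of powers of commuting matrices.
\<close>

section \<open>Probability vectors and stochastic matrices\<close>

lemma probability_on_bounds:
  assumes "probability_on S \<mu>" "x \<in> S"
  shows "0 \<le> \<mu> x" "\<mu> x \<le> 1"
proof -
  show "0 \<le> \<mu> x" using assms by (auto simp: probability_on_def)
  have "sum \<mu> {x} \<le> 1"
    using assms by (intro finite_sum_le_has_sum[where f = \<mu> and A = S]) (auto simp: probability_on_def)
  then show "\<mu> x \<le> 1" by simp
qed

lemma probability_on_summable: "probability_on S \<mu> \<Longrightarrow> \<mu> summable_on S"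
  by (auto simp: probability_on_def summable_on_def)

lemma summable_mult_bounded:
  fixes f g :: "'a \<Rightarrow> real"
  assumes "f summable_on S" "\<And>x. x \<in> S \<Longrightarrow> 0 \<le> f x" "\<And>x. x \<in> S \<Longrightarrow> 0 \<le> g x \<and> g x \<le> 1"
  shows "(\<lambda>x. f x * g x) summable_on S"
  using assms by (intro summable_on_comparison_test[OF assms(1)]) (auto intro!: mult_left_le mult_nonneg_nonneg)

lemma probability_on_cong:
  assumes "\<And>x. x \<in> S \<Longrightarrow> \<mu> x = \<nu> x"
  shows "probability_on S \<mu> \<longleftrightarrow> probability_on S \<nu>"
  unfolding probability_on_def using has_sum_cong[of S \<mu> \<nu> 1] assms by auto

lemma has_sum_finite_sum:
  fixes f :: "'i \<Rightarrow> 'a \<Rightarrow> real"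
  assumes "finite I" "\<And>i. i \<in> I \<Longrightarrow> (f i has_sum s i) A"
  shows "((\<lambda>x. \<Sum>i\<in>I. f i x) has_sum (\<Sum>i\<in>I. s i)) A"
  using assms by (induction I rule: finite_induct) (auto intro: has_sum_add)

text \<open>
  A mixture of probability vectors is a probability vector, by exchanging two sums of nonnegative
  terms.  The index set may differ from the state space: \<open>vec_mult\<close>, the powers of a kernel, the
  product kernel and the Poisson representation of the heat kernel are all mixtures.
\<close>

lemma probability_on_mixture:
  fixes \<mu> :: "'u \<Rightarrow> real" and A :: "'u \<Rightarrow> 'a \<Rightarrow> real"
  assumes \<mu>: "probability_on U \<mu>" and A: "\<And>u. u \<in> U \<Longrightarrow> probability_on S (A u)"
  shows "probability_on S (\<lambda>y. \<Sum>\<^sub>\<infinity>u\<in>U. \<mu> u * A u y)"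
proof -
  define f where "f = (\<lambda>(u, y). \<mu> u * A u y)"
  have pos: "0 \<le> \<mu> u" "0 \<le> A u y" "A u y \<le> 1" if "u \<in> U" "y \<in> S" for u y
    using probability_on_bounds[OF \<mu>] probability_on_bounds[OF A] that by auto
  have rows: "((\<lambda>y. f (u, y)) has_sum \<mu> u) S" if "u \<in> U" for u
    using has_sum_cmult_right[of "A u" S 1 "\<mu> u"] A[OF that] by (simp add: f_def probability_on_def)
  have \<mu>1: "(\<mu> has_sum 1) U" using \<mu> by (simp add: probability_on_def)
  have "f summable_on U \<times> S"
    using pos by (intro summable_on_SigmaI[OF rows probability_on_summable[OF \<mu>]]) (auto simp: f_def)
  then have "(f has_sum 1) (U \<times> S)"
    by (intro has_sum_SigmaI[where g = \<mu>]) (use rows \<mu>1 in auto)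
  then have "((\<lambda>(y, u). f (u, y)) has_sum 1) (S \<times> U)"
    by (rule has_sum_swap[THEN iffD1])
  moreover have "(\<lambda>u. \<mu> u * A u y) summable_on U" if "y \<in> S" for y
    using probability_on_summable[OF \<mu>] pos that by (intro summable_mult_bounded) auto
  ultimately have "((\<lambda>y. \<Sum>\<^sub>\<infinity>u\<in>U. \<mu> u * A u y) has_sum 1) S"
    by (intro has_sum_SigmaD[where A = S and B = "\<lambda>_. U" and f = "\<lambda>(y, u). f (u, y)"]) (auto simp: f_def)
  then show ?thesis
    using pos by (auto simp: probability_on_def intro!: infsum_nonneg)
qed

lemma probability_on_vec_mult:
  assumes "probability_on S \<mu>" "stochastic S A"
  shows "probability_on S (vec_mult S \<mu> A)"
  unfolding vec_mult_def
  by (rule probability_on_mixture[OF assms(1)]) (use assms(2) in \<open>simp add: stochastic_def\<close>)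

lemma probability_on_product_measure:
  assumes "finite I" and "\<And>i. i \<in> I \<Longrightarrow> probability_on (X i) (\<mu> i)"
  shows "probability_on (Pi\<^sub>E I X) (product_measure I \<mu>)"
proof -
  have "infsum (product_measure I \<mu>) (Pi\<^sub>E I X) = (\<Prod>i\<in>I. infsum (\<mu> i) (X i))"
    unfolding product_measure_def
  proof (rule infsum_prod_PiE_abs[OF assms(1)])
    show "(\<lambda>x. norm (\<mu> i x)) summable_on X i" if "i \<in> I" for i
      using probability_on_summable[OF assms(2)[OF that]]
      by (rule summable_on_iff_abs_summable_on_real[THEN iffD1])
  qed
  also have "\<dots> = 1"
    using assms by (intro prod.neutral) (auto simp: probability_on_def infsumI)
  finally have *: "infsum (product_measure I \<mu>) (Pi\<^sub>E I X) = 1" .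
  \<comment> \<open>A nonzero infinite sum can only come from a summable family, since the default value is 0.\<close>
  then have "product_measure I \<mu> summable_on Pi\<^sub>E I X"
    using infsum_not_exists by fastforce
  then show ?thesis using * assms
    by (auto simp: probability_on_def has_sum_iff product_measure_def PiE_iff intro!: prod_nonneg)
qed

lemma stochastic_id_mat: "stochastic S id_mat"
proof -
  have "(id_mat x has_sum 1) S" if "x \<in> S" for x
    using has_sum_cong_neutral[of S "{x}" "id_mat x" "\<lambda>_. 1" 1] that
    by (auto simp: id_mat_def has_sum_finite_iff)
  then show ?thesis by (auto simp: stochastic_def probability_on_def id_mat_def)
qed

lemma stochastic_mat_pow:
  assumes "stochastic S K"
  shows "stochastic S (mat_pow S K m)"
proof (induction m)
  case 0
  then show ?case by (simp add: stochastic_id_mat)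
next
  case (Suc m)
  have "mat_pow S K (Suc m) x = vec_mult S (K x) (mat_pow S K m)" for x
    by (simp add: mat_mult_def vec_mult_def fun_eq_iff)
  then show ?case
    using probability_on_vec_mult[OF _ Suc] assms by (simp add: stochastic_def del: mat_pow.simps)
qed

lemma stochastic_tensor:
  assumes "finite I" "\<And>i. i \<in> I \<Longrightarrow> stochastic (X i) (A i)"
  shows "stochastic (Pi\<^sub>E I X) (tensor I A)"
  unfolding stochastic_def
proof
  fix x assume x: "x \<in> Pi\<^sub>E I X"
  have "tensor I A x = product_measure I (\<lambda>i. A i (x i))"
    by (simp add: tensor_def product_measure_def fun_eq_iff)
  moreover have "probability_on (X i) (A i (x i))" if "i \<in> I" for i
    using assms(2)[OF that] PiE_mem[OF x that] unfolding stochastic_def by blast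
  ultimately show "probability_on (Pi\<^sub>E I X) (tensor I A x)"
    using probability_on_product_measure[OF assms(1)] by metis
qed

lemma stochastic_product_kernel:
  assumes "finite I" "I \<noteq> {}" "\<And>i. i \<in> I \<Longrightarrow> 0 < p i"
    and K: "\<And>i. i \<in> I \<Longrightarrow> stochastic (X i) (K i)"
  shows "stochastic (Pi\<^sub>E I X) (product_kernel I p K)"
proof -
  have "0 < sum p I" using assms(1-3) by (rule sum_pos)
  have w: "probability_on I (\<lambda>i. p i / sum p I)"
    unfolding probability_on_def
  proof
    show "\<forall>i\<in>I. 0 \<le> p i / sum p I"
      using assms(3) \<open>0 < sum p I\<close> by (auto intro!: divide_nonneg_pos less_imp_le)
    have "(\<Sum>i\<in>I. p i / sum p I) = 1"
      using \<open>0 < sum p I\<close> by (simp flip: sum_divide_distrib)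
    then show "((\<lambda>i. p i / sum p I) has_sum 1) I"
      using \<open>finite I\<close> by (simp add: has_sum_finite_iff)
  qed
  have "stochastic (Pi\<^sub>E I X) (tensor I ((\<lambda>_. id_mat)(i := K i)))" if "i \<in> I" for i
    by (rule stochastic_tensor[OF \<open>finite I\<close>]) (auto simp: stochastic_id_mat K)
  then have "probability_on (Pi\<^sub>E I X) (tensor I ((\<lambda>_. id_mat)(i := K i)) x)"
    if "i \<in> I" "x \<in> Pi\<^sub>E I X" for i x
    using that unfolding stochastic_def by blast
  then have "probability_on (Pi\<^sub>E I X)
      (\<lambda>y. \<Sum>\<^sub>\<infinity>i\<in>I. p i / sum p I * tensor I ((\<lambda>_. id_mat)(i := K i)) x y)"
    if "x \<in> Pi\<^sub>E I X" for x
    using that by (intro probability_on_mixture[OF w])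
  moreover have "product_kernel I p K x =
      (\<lambda>y. \<Sum>\<^sub>\<infinity>i\<in>I. p i / sum p I * tensor I ((\<lambda>_. id_mat)(i := K i)) x y)" for x
    unfolding product_kernel_def using \<open>finite I\<close> by simp
  ultimately show ?thesis
    by (simp add: stochastic_def)
qed

section \<open>Heat kernels as power series in time\<close>

unbundle no vec_syntax
unbundle fps_syntax

text \<open>
  The entries of \<open>exp (s X A)\<close> as formal power series in the time variable \<open>X\<close>.  The factor \<open>s\<close> is
  kept separate because the coordinates of a product chain run at different speeds.
\<close>

definition exp_fps :: "'a set \<Rightarrow> ('a \<Rightarrow> 'a \<Rightarrow> real) \<Rightarrow> real \<Rightarrow> 'a \<Rightarrow> 'a \<Rightarrow> real fps" where
  "exp_fps S A s x y = Abs_fps (\<lambda>m. s ^ m * mat_pow S A m x y / fact m)"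

text \<open>
  Uniqueness for the backward equation: a column \<open>c\<close> of power series with \<open>c' = A c\<close> and the
  column \<open>y\<close> of the identity as its constant term is the column \<open>y\<close> of the exponential of \<open>A\<close>,
  because the equation determines the coefficients recursively.  Both formulas for
  exponentials below are instances.
\<close>

lemma mat_pow_eq_fps_nth:
  fixes c :: "'a \<Rightarrow> real fps"
  assumes "\<And>x. x \<in> S \<Longrightarrow> c x $ 0 = id_mat x y"
    and step: "\<And>x m. x \<in> S \<Longrightarrow> ((\<lambda>z. A x z * c z $ m) has_sum fps_deriv (c x) $ m) S"
    and "x \<in> S"
  shows "mat_pow S A m x y = fact m * c x $ m"
  using \<open>x \<in> S\<close>
proof (induction m arbitrary: x)
  case 0
  then show ?case using assms(1) by simp
next
  case (Suc m)
  have "mat_pow S A (Suc m) x y = (\<Sum>\<^sub>\<infinity>z\<in>S. fact m * (A x z * c z $ m))"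
    using Suc.IH by (auto simp: mat_mult_def mult_ac intro!: infsum_cong)
  also have "\<dots> = fact m * fps_deriv (c x) $ m"
    using step[OF Suc.prems] by (intro infsumI has_sum_cmult_right)
  finally show ?case by (simp add: fps_deriv_nth algebra_simps del: mat_pow.simps)
qed

text \<open>
  Applying a matrix row commutes with multiplication by a power series \<open>q\<close> that does not depend
  on the summation variable: every coefficient of the product is a finite sum.
\<close>

lemma has_sum_fps_mult_nth:
  fixes c :: "'a \<Rightarrow> real fps"
  assumes "\<And>m. ((\<lambda>z. a z * c z $ m) has_sum b $ m) S"
  shows "((\<lambda>z. a z * (q * c z) $ m) has_sum (q * b) $ m) S"
proof -
  have "((\<lambda>z. \<Sum>j=0..m. q $ j * (a z * c z $ (m - j))) has_sum (\<Sum>j=0..m. q $ j * b $ (m - j))) S"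
    by (rule has_sum_finite_sum) (intro finite_atLeastAtMost has_sum_cmult_right assms)+
  then show ?thesis
    by (simp add: fps_mult_nth sum_distrib_left mult.left_commute)
qed

text \<open>
  The backward equation for the exponential of \<open>s K\<close>.  Stochasticity bounds the powers of \<open>K\<close> by 1,
  which makes the sum over the states converge.
\<close>

lemma exp_fps_deriv_has_sum:
  assumes K: "stochastic S K" and x: "x \<in> S" and y: "y \<in> S"
  shows "((\<lambda>z. s * K x z * exp_fps S K s z y $ m) has_sum fps_deriv (exp_fps S K s x y) $ m) S"
proof -
  have row: "probability_on S (K x)" using K x by (simp add: stochastic_def)
  have "0 \<le> mat_pow S K m z y \<and> mat_pow S K m z y \<le> 1" if "z \<in> S" for z
    using stochastic_mat_pow[OF K, of m] that y probability_on_bounds[of S "mat_pow S K m z" y]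
    by (simp add: stochastic_def)
  then have "(\<lambda>z. K x z * mat_pow S K m z y) summable_on S"
    using probability_on_summable[OF row] probability_on_bounds[OF row]
    by (intro summable_mult_bounded) auto
  then have "((\<lambda>z. K x z * mat_pow S K m z y) has_sum mat_pow S K (Suc m) x y) S"
    by (simp add: mat_mult_def)
  from has_sum_cmult_right[OF this, of "s ^ Suc m / fact m"] show ?thesis
    by (simp add: exp_fps_def fps_deriv_nth field_simps del: mat_pow.simps of_nat_Suc)
qed

lemma fps_conv_radius_exp_fps:
  assumes "stochastic S K" "x \<in> S" "y \<in> S"
  shows "fps_conv_radius (exp_fps S K s x y) = \<infinity>"
  unfolding fps_conv_radius_def
proof (rule conv_radius_inftyI'')
  fix z :: real
  have "norm (exp_fps S K s x y $ m * z ^ m) \<le> \<bar>s * z\<bar> ^ m / fact m" for m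
  proof -
    have "0 \<le> mat_pow S K m x y" "mat_pow S K m x y \<le> 1"
      using stochastic_mat_pow[OF assms(1)] assms by (auto simp: stochastic_def intro: probability_on_bounds)
    then have "mat_pow S K m x y * \<bar>s * z\<bar> ^ m / fact m \<le> 1 * \<bar>s * z\<bar> ^ m / fact m"
      by (intro divide_right_mono mult_right_mono) auto
    then show ?thesis
      using \<open>0 \<le> mat_pow S K m x y\<close>
      by (simp add: exp_fps_def abs_mult power_mult_distrib power_abs mult_ac)
  qed
  moreover have "summable (\<lambda>m. \<bar>s * z\<bar> ^ m / fact m)"
    using summable_exp[of "\<bar>s * z\<bar>"] by (simp add: field_simps)
  ultimately show "summable (\<lambda>m. exp_fps S K s x y $ m * z ^ m)"
    by (intro summable_comparison_test'[where N = 0 and f = "\<lambda>m. exp_fps S K s x y $ m * z ^ m"])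
qed

lemma eval_exp_fps_rescale:
  "eval_fps (exp_fps S K s x y) z = eval_fps (exp_fps S K (s * z) x y) 1"
  by (simp add: eval_fps_def exp_fps_def power_mult_distrib mult_ac)

text \<open>
  Passing from \<open>exp (- t (I - K))\<close> to \<open>exp (- t) exp (t K)\<close> makes all terms nonnegative when
  \<open>t \<ge> 0\<close>.  Both sides solve the backward equation for the matrix \<open>- t (I - K)\<close>, the right
  one by the product rule.
\<close>

lemma heat_kernel_eq_exp_fps:
  assumes K: "stochastic S K" and x: "x \<in> S" and y: "y \<in> S"
  shows "heat_kernel S K t x y = exp (- t) * eval_fps (exp_fps S K t x y) 1"
proof -
  define A where "A = (\<lambda>x y. - t * (id_mat x y - K x y))"
  define g where "g = (\<lambda>x. exp_fps S K t x y)"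
  define c where "c = (\<lambda>x. fps_exp (- t) * g x)"
  have pow: "mat_pow S A m x y = fact m * c x $ m" for m
  proof (rule mat_pow_eq_fps_nth[OF _ _ x])
    fix x assume "x \<in> S"
    then show "c x $ 0 = id_mat x y" by (simp add: c_def g_def exp_fps_def)
  next
    fix x m assume x: "x \<in> S"
    \<comment> \<open>The two terms of the product rule correspond to the summands \<open>t K\<close> and \<open>- t I\<close> of the matrix.\<close>
    have 1: "((\<lambda>z. t * K x z * c z $ m) has_sum (fps_exp (- t) * fps_deriv (g x)) $ m) S"
      unfolding c_def g_def by (intro has_sum_fps_mult_nth exp_fps_deriv_has_sum[OF K x y])
    have 2: "((\<lambda>z. - t * id_mat x z * c z $ m) has_sum - t * c x $ m) S"
      using has_sum_cong_neutral[of S "{x}" "\<lambda>z. - t * id_mat x z * c z $ m"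
          "\<lambda>z. - t * id_mat x z * c z $ m" "- t * c x $ m"] x
      by (auto simp: has_sum_finite_iff id_mat_def)
    have "fps_deriv (c x) $ m = - t * c x $ m + (fps_exp (- t) * fps_deriv (g x)) $ m"
      by (simp add: c_def mult.assoc)
    moreover have "(\<lambda>z. A x z * c z $ m) = (\<lambda>z. - t * id_mat x z * c z $ m + t * K x z * c z $ m)"
      by (simp add: A_def fun_eq_iff algebra_simps)
    ultimately show "((\<lambda>z. A x z * c z $ m) has_sum fps_deriv (c x) $ m) S"
      using has_sum_add[OF 2 1] by (simp only:)
  qed
  have "heat_kernel S K t x y = eval_fps (c x) 1"
    unfolding heat_kernel_def mat_exp_def A_def[symmetric] by (simp add: eval_fps_def pow)
  also have "\<dots> = exp (- t) * eval_fps (exp_fps S K t x y) 1"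
    unfolding c_def g_def using fps_conv_radius_exp_fps[OF assms] by (subst eval_fps_mult) auto
  finally show ?thesis .
qed

text \<open>
  The heat kernel is the mixture of the powers of \<open>K\<close> with Poisson weights
  \<open>exp (- t) * t ^ m / m!\<close>.
\<close>

lemma stochastic_heat_kernel:
  assumes K: "stochastic S K" and "0 \<le> t"
  shows "stochastic S (heat_kernel S K t)"
  unfolding stochastic_def
proof
  fix x assume x: "x \<in> S"
  let ?w = "\<lambda>m. exp (- t) * (t ^ m / fact m)"
  have "(\<lambda>m. t ^ m / fact m) sums exp t"
    using exp_converges[of t] by (simp add: field_simps)
  from sums_mult[OF this, of "exp (- t)"] have "?w sums 1" by (simp add: exp_minus)
  then have w: "probability_on UNIV ?w"
    using \<open>0 \<le> t\<close> by (auto simp: probability_on_def intro!: sums_nonneg_imp_has_sum)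
  have rows: "probability_on S (mat_pow S K m x)" for m
    using stochastic_mat_pow[OF K] x by (simp add: stochastic_def)
  have "heat_kernel S K t x y = (\<Sum>\<^sub>\<infinity>m. ?w m * mat_pow S K m x y)" if y: "y \<in> S" for y
  proof -
    have "summable (\<lambda>m. exp_fps S K t x y $ m * 1 ^ m)"
      using fps_conv_radius_exp_fps[OF K x y] by (intro summable_fps) simp
    then have "(\<lambda>m. exp_fps S K t x y $ m * 1 ^ m) sums eval_fps (exp_fps S K t x y) 1"
      by (simp add: eval_fps_def summable_sums)
    from sums_mult[OF this, of "exp (- t)"]
    have "(\<lambda>m. ?w m * mat_pow S K m x y) sums heat_kernel S K t x y"
      by (simp add: heat_kernel_eq_exp_fps[OF K x y] exp_fps_def mult_ac)
    then have "((\<lambda>m. ?w m * mat_pow S K m x y) has_sum heat_kernel S K t x y) UNIV"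
      using \<open>0 \<le> t\<close> probability_on_bounds[OF rows y] by (intro sums_nonneg_imp_has_sum) auto
    then show ?thesis by (simp add: infsumI)
  qed
  moreover have "probability_on S (\<lambda>y. \<Sum>\<^sub>\<infinity>m. ?w m * mat_pow S K m x y)"
    by (rule probability_on_mixture[OF w rows])
  ultimately show "probability_on S (heat_kernel S K t x)"
    using probability_on_cong[of S "heat_kernel S K t x"
        "\<lambda>y. \<Sum>\<^sub>\<infinity>m. ?w m * mat_pow S K m x y"] by blast
qed

section \<open>The heat kernel of a product chain\<close>

lemma eval_fps_prod:
  fixes f :: "'i \<Rightarrow> real fps"
  assumes "finite I" "\<And>i. i \<in> I \<Longrightarrow> fps_conv_radius (f i) = \<infinity>"
  shows "eval_fps (\<Prod>i\<in>I. f i) z = (\<Prod>i\<in>I. eval_fps (f i) z) \<and> fps_conv_radius (\<Prod>i\<in>I. f i) = \<infinity>"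
  using assms
proof (induction I rule: finite_induct)
  case (insert i I)
  have "fps_conv_radius (f i * (\<Prod>i\<in>I. f i)) \<ge> min (fps_conv_radius (f i)) (fps_conv_radius (\<Prod>i\<in>I. f i))"
    by (rule fps_conv_radius_mult)
  with insert show ?case by (simp add: eval_fps_mult)
qed auto

lemma prod_fps_nth_0:
  fixes f :: "'i \<Rightarrow> real fps"
  assumes "finite I"
  shows "(\<Prod>i\<in>I. f i) $ 0 = (\<Prod>i\<in>I. f i $ 0)"
  using assms by (induction I rule: finite_induct) simp_all

lemma sqrt_prod:
  assumes "finite I"
  shows "sqrt (\<Prod>i\<in>I. f i) = (\<Prod>i\<in>I. sqrt (f i))"
  using assms by (induction I rule: finite_induct) (simp_all add: real_sqrt_mult)

lemma fps_deriv_prod: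
  fixes f :: "'i \<Rightarrow> real fps"
  assumes "finite I"
  shows "fps_deriv (\<Prod>i\<in>I. f i) = (\<Sum>i\<in>I. (\<Prod>j\<in>I - {i}. f j) * fps_deriv (f i))"
  using assms
proof (induction I rule: finite_induct)
  case (insert a I)
  have "(\<Prod>j\<in>insert a I - {i}. f j) = f a * (\<Prod>j\<in>I - {i}. f j)" if "i \<in> I" for i
  proof -
    have "insert a I - {i} = insert a (I - {i})" using insert that by auto
    then show ?thesis using insert by simp
  qed
  moreover have "insert a I - {a} = I" using insert by auto
  ultimately show ?case
    using insert by (simp add: sum_distrib_left mult_ac)
qed simp

text \<open>
  Row \<open>x\<close> of \<open>1 \<otimes> \<dots> \<otimes> A \<otimes> \<dots> \<otimes> 1\<close> vanishes off the line through \<open>x\<close> in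
  direction \<open>i\<close>, so a sum over the product space collapses to a sum over the \<open>i\<close>-th factor.
\<close>

lemma has_sum_tensor_single:
  fixes c :: "('i \<Rightarrow> 'a) \<Rightarrow> real"
  assumes "finite I" "i \<in> I" "x \<in> Pi\<^sub>E I X"
    and "((\<lambda>u. A (x i) u * c (x(i := u))) has_sum s) (X i)"
  shows "((\<lambda>z. tensor I ((\<lambda>_. id_mat)(i := A)) x z * c z) has_sum s) (Pi\<^sub>E I X)"
proof -
  let ?T = "tensor I ((\<lambda>_. id_mat)(i := A))" and ?h = "\<lambda>u. x(i := u)"
  have "?T x (?h u) = A (x i) u" for u
  proof -
    have "?T x (?h u) = A (x i) u * (\<Prod>j\<in>I - {i}. 1)"
      unfolding tensor_def using assms(1,2)
      by (subst prod.remove[of I i]) (auto intro!: prod.cong simp: id_mat_def)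
    then show ?thesis by simp
  qed
  moreover have "inj_on ?h (X i)"
    by (auto intro!: inj_onI dest: fun_upd_eqD)
  ultimately have "((\<lambda>z. ?T x z * c z) has_sum s) (?h ` X i)"
    using assms(4) by (subst has_sum_reindex) (auto simp: o_def)
  moreover have "?h ` X i \<subseteq> Pi\<^sub>E I X"
    using assms(2,3) by (auto simp: PiE_iff extensional_def)
  moreover have "?T x z = 0" if z: "z \<in> Pi\<^sub>E I X - ?h ` X i" for z
  proof -
    have "\<exists>j\<in>I - {i}. x j \<noteq> z j"
    proof (rule ccontr)
      assume "\<not> ?thesis"
      then have "z j = ?h (z i) j" for j
        using PiE_arb[OF assms(3), of j] PiE_arb[of z I X j] z by (cases "j \<in> I") auto
      then have "z = ?h (z i)" by (rule ext)
      moreover have "z i \<in> X i" using z assms(2) by (auto dest: PiE_mem)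
      ultimately show False using z by blast
    qed
    then show ?thesis
      using assms(1) by (auto simp: tensor_def id_mat_def)
  qed
  ultimately show ?thesis
    using has_sum_cong_neutral[of "?h ` X i" "Pi\<^sub>E I X" "\<lambda>z. ?T x z * c z" "\<lambda>z. ?T x z * c z" s]
    by auto
qed

text \<open>
  The product kernel is a sum of commuting matrices, each acting on one coordinate, so its exponential
  is the tensor product of the exponentials.  In terms of power series: the derivative of a product
  has one term for each factor, and the term of the \<open>i\<close>-th factor is the \<open>i\<close>-th summand of
  the product kernel applied to the product.
\<close>

lemma exp_fps_product_kernel:
  fixes K :: "'i \<Rightarrow> 'a \<Rightarrow> 'a \<Rightarrow> real"
  assumes I: "finite I" and K: "\<And>i. i \<in> I \<Longrightarrow> stochastic (X i) (K i)"
    and x: "x \<in> Pi\<^sub>E I X" and y: "y \<in> Pi\<^sub>E I X"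
  shows "exp_fps (Pi\<^sub>E I X) (product_kernel I p K) 1 x y =
     (\<Prod>i\<in>I. exp_fps (X i) (K i) (p i / sum p I) (x i) (y i))"
proof -
  define w where "w = (\<lambda>i. p i / sum p I)"
  define g where "g = (\<lambda>i u. exp_fps (X i) (K i) (w i) u (y i))"
  define c where "c = (\<lambda>x. \<Prod>i\<in>I. g i (x i))"
  have "mat_pow (Pi\<^sub>E I X) (product_kernel I p K) m x y = fact m * c x $ m" for m
  proof (rule mat_pow_eq_fps_nth[OF _ _ x])
    fix x assume x: "x \<in> Pi\<^sub>E I X"
    have "c x $ 0 = (\<Prod>i\<in>I. id_mat (x i) (y i))"
      unfolding c_def prod_fps_nth_0[OF I] by (simp add: g_def exp_fps_def)
    also have "\<dots> = id_mat x y"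
    proof (cases "x = y")
      case False
      then obtain i where "i \<in> I" "x i \<noteq> y i"
        using PiE_ext[OF x y] by blast
      then show ?thesis using I False by (auto simp: id_mat_def)
    qed (simp add: id_mat_def)
    finally show "c x $ 0 = id_mat x y" .
  next
    fix x m assume x: "x \<in> Pi\<^sub>E I X"
    \<comment> \<open>The weight is absorbed into the kernel of the coordinate, matching the rescaled time of \<open>g i\<close>.\<close>
    have *: "((\<lambda>z. tensor I ((\<lambda>_. id_mat)(i := (\<lambda>u v. w i * K i u v))) x z * c z $ m) has_sum
        ((\<Prod>j\<in>I - {i}. g j (x j)) * fps_deriv (g i (x i))) $ m) (Pi\<^sub>E I X)" if i: "i \<in> I" for i
    proof (rule has_sum_tensor_single[OF I i x])
      have c_upd: "c (x(i := u)) = (\<Prod>j\<in>I - {i}. g j (x j)) * g i u" for u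
        unfolding c_def by (subst prod.remove[OF I i]) (simp add: mult.commute)
      show "((\<lambda>u. w i * K i (x i) u * c (x(i := u)) $ m) has_sum
          ((\<Prod>j\<in>I - {i}. g j (x j)) * fps_deriv (g i (x i))) $ m) (X i)"
        unfolding c_upd unfolding g_def
        using K[OF i] PiE_mem[OF x i] PiE_mem[OF y i]
        by (intro has_sum_fps_mult_nth exp_fps_deriv_has_sum)
    qed
    have tensor: "tensor I ((\<lambda>_. id_mat)(i := (\<lambda>u v. w i * K i u v))) x z =
        w i * tensor I ((\<lambda>_. id_mat)(i := K i)) x z" if "i \<in> I" for i z
      unfolding tensor_def by (subst (1 2) prod.remove[OF I that]) (simp add: mult.assoc)
    have "((\<lambda>z. \<Sum>i\<in>I. w i * tensor I ((\<lambda>_. id_mat)(i := K i)) x z * c z $ m) has_sum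
        (\<Sum>i\<in>I. ((\<Prod>j\<in>I - {i}. g j (x j)) * fps_deriv (g i (x i))) $ m)) (Pi\<^sub>E I X)"
      using * tensor by (intro has_sum_finite_sum[OF I]) simp
    then show "((\<lambda>z. product_kernel I p K x z * c z $ m) has_sum fps_deriv (c x) $ m) (Pi\<^sub>E I X)"
      unfolding c_def fps_deriv_prod[OF I]
      by (simp add: product_kernel_def w_def fps_sum_nth sum_distrib_right)
  qed
  then have "exp_fps (Pi\<^sub>E I X) (product_kernel I p K) 1 x y = c x"
    by (simp add: exp_fps_def fps_eq_iff)
  then show ?thesis by (simp add: c_def g_def w_def)
qed

text \<open>
  The factors \<open>exp (- t * p i / q)\<close> multiply to \<open>exp (- t)\<close> because the weights \<open>p i / q\<close> sum to 1.
\<close>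

lemma heat_kernel_product_kernel:
  assumes I: "finite I" "I \<noteq> {}" and p: "\<And>i. i \<in> I \<Longrightarrow> 0 < p i"
    and K: "\<And>i. i \<in> I \<Longrightarrow> stochastic (X i) (K i)"
    and x: "x \<in> Pi\<^sub>E I X" and y: "y \<in> Pi\<^sub>E I X"
  shows "heat_kernel (Pi\<^sub>E I X) (product_kernel I p K) t x y =
     tensor I (\<lambda>i. heat_kernel (X i) (K i) (p i * t / sum p I)) x y"
proof -
  have "0 < sum p I" using I p by (rule sum_pos)
  have mem: "x i \<in> X i" "y i \<in> X i" if "i \<in> I" for i
    using that x y by (auto simp: PiE_iff)
  let ?g = "\<lambda>i s. exp_fps (X i) (K i) s (x i) (y i)"
  have "(\<Prod>i\<in>I. exp (- (p i * t / sum p I))) = exp (\<Sum>i\<in>I. - (p i * t / sum p I))"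
    by (rule exp_sum[symmetric, OF \<open>finite I\<close>])
  also have "(\<Sum>i\<in>I. - (p i * t / sum p I)) = - t"
    using \<open>0 < sum p I\<close>
    by (simp add: sum_negf sum_divide_distrib[symmetric] sum_distrib_right[symmetric])
  finally have exp: "exp (- t) = (\<Prod>i\<in>I. exp (- (p i * t / sum p I)))" ..
  have "heat_kernel (Pi\<^sub>E I X) (product_kernel I p K) t x y =
      exp (- t) * eval_fps (exp_fps (Pi\<^sub>E I X) (product_kernel I p K) 1 x y) t"
    using heat_kernel_eq_exp_fps[OF stochastic_product_kernel[where p = p, OF I p K] x y]
    by (simp add: eval_exp_fps_rescale[of _ _ 1])
  also have "\<dots> = exp (- t) * (\<Prod>i\<in>I. eval_fps (?g i (p i / sum p I)) t)"
    by (simp add: exp_fps_product_kernel[OF \<open>finite I\<close> K x y]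
        eval_fps_prod[OF \<open>finite I\<close> fps_conv_radius_exp_fps[OF K mem]])
  also have "\<dots> = (\<Prod>i\<in>I. exp (- (p i * t / sum p I)) * eval_fps (?g i (p i * t / sum p I)) 1)"
    unfolding exp prod.distrib by (simp add: eval_exp_fps_rescale[where z = t])
  also have "\<dots> = (\<Prod>i\<in>I. heat_kernel (X i) (K i) (p i * t / sum p I) (x i) (y i))"
    by (intro prod.cong refl heat_kernel_eq_exp_fps[symmetric] K mem)
  finally show ?thesis by (simp add: tensor_def)
qed

lemma vec_mult_tensor:
  assumes "finite I" and "\<And>i. i \<in> I \<Longrightarrow> probability_on (X i) (\<mu> i)"
    and A: "\<And>i. i \<in> I \<Longrightarrow> stochastic (X i) (A i)" and y: "y \<in> Pi\<^sub>E I X"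
  shows "vec_mult (Pi\<^sub>E I X) (product_measure I \<mu>) (tensor I A) y =
    product_measure I (\<lambda>i. vec_mult (X i) (\<mu> i) (A i)) y"
proof -
  have "(\<lambda>x. norm (\<mu> i x * A i x (y i))) summable_on X i" if "i \<in> I" for i
  proof -
    have "0 \<le> A i x (y i)" "A i x (y i) \<le> 1" if "x \<in> X i" for x
      using probability_on_bounds[of "X i" "A i x" "y i"] A[OF \<open>i \<in> I\<close>] PiE_mem[OF y \<open>i \<in> I\<close>] that
      by (auto simp: stochastic_def)
    then have "(\<lambda>x. \<mu> i x * A i x (y i)) summable_on X i"
      using probability_on_summable probability_on_bounds(1) assms(2)[OF that]
      by (intro summable_mult_bounded) auto
    then show ?thesis
      by (rule summable_on_iff_abs_summable_on_real[THEN iffD1])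
  qed
  then have "infsum (\<lambda>x. \<Prod>i\<in>I. \<mu> i (x i) * A i (x i) (y i)) (Pi\<^sub>E I X) =
      (\<Prod>i\<in>I. \<Sum>\<^sub>\<infinity>u\<in>X i. \<mu> i u * A i u (y i))"
    by (rule infsum_prod_PiE_abs[OF \<open>finite I\<close>])
  then show ?thesis
    by (simp add: vec_mult_def product_measure_def tensor_def prod.distrib)
qed

lemma vec_mult_heat_kernel_product:
  assumes "finite I" "I \<noteq> {}" and "\<And>i. i \<in> I \<Longrightarrow> 0 < p i"
    and "\<And>i. i \<in> I \<Longrightarrow> stochastic (X i) (K i)" and "\<And>i. i \<in> I \<Longrightarrow> probability_on (X i) (\<mu> i)"
    and y: "y \<in> Pi\<^sub>E I X" and "0 \<le> t"
  shows "vec_mult (Pi\<^sub>E I X) (product_measure I \<mu>) (heat_kernel (Pi\<^sub>E I X) (product_kernel I p K) t) y =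
    product_measure I (\<lambda>i. vec_mult (X i) (\<mu> i) (heat_kernel (X i) (K i) (p i * t / sum p I))) y"
proof -
  have "0 < sum p I" using assms(1-3) by (rule sum_pos)
  then have t: "0 \<le> p i * t / sum p I" if "i \<in> I" for i
    using assms(3)[OF that] \<open>0 \<le> t\<close> by (simp add: less_imp_le)
  have "vec_mult (Pi\<^sub>E I X) (product_measure I \<mu>) (heat_kernel (Pi\<^sub>E I X) (product_kernel I p K) t) y =
    vec_mult (Pi\<^sub>E I X) (product_measure I \<mu>) (tensor I (\<lambda>i. heat_kernel (X i) (K i) (p i * t / sum p I))) y"
    unfolding vec_mult_def
  proof (rule infsum_cong)
    fix x assume x: "x \<in> Pi\<^sub>E I X"
    show "product_measure I \<mu> x * heat_kernel (Pi\<^sub>E I X) (product_kernel I p K) t x y =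
        product_measure I \<mu> x * tensor I (\<lambda>i. heat_kernel (X i) (K i) (p i * t / sum p I)) x y"
      by (subst heat_kernel_product_kernel[OF assms(1-4) x y]) auto
  qed
  also have "\<dots> = product_measure I (\<lambda>i. vec_mult (X i) (\<mu> i) (heat_kernel (X i) (K i) (p i * t / sum p I))) y"
    using assms(1,4,5) y t by (intro vec_mult_tensor stochastic_heat_kernel)
  finally show ?thesis .
qed

section \<open>Factorisation of the Hellinger affinity\<close>

text \<open>
  The Hellinger affinity, also called the Bhattacharyya coefficient.
\<close>

definition affinity :: "'a set \<Rightarrow> ('a \<Rightarrow> real) \<Rightarrow> ('a \<Rightarrow> real) \<Rightarrow> real" where
  "affinity S \<mu> \<nu> = (\<Sum>\<^sub>\<infinity>y\<in>S. sqrt (\<mu> y * \<nu> y))"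

lemma affinity_summable:
  assumes \<mu>: "probability_on S \<mu>" and \<nu>: "probability_on S \<nu>"
  shows "(\<lambda>y. sqrt (\<mu> y * \<nu> y)) summable_on S"
proof (rule summable_on_comparison_test)
  show "(\<lambda>y. \<mu> y + \<nu> y) summable_on S"
    using assms by (intro summable_on_add probability_on_summable)
  fix y assume "y \<in> S"
  then have pos: "0 \<le> \<mu> y" "0 \<le> \<nu> y" using assms by (auto intro: probability_on_bounds)
  then show "0 \<le> sqrt (\<mu> y * \<nu> y)" by simp
  show "sqrt (\<mu> y * \<nu> y) \<le> \<mu> y + \<nu> y"
    using arith_geo_mean_sqrt[OF pos] pos by simp
qed

text \<open>
  Expand the square; the two pure terms sum to 1 each.
\<close>

lemma hellinger_power2:
  assumes \<mu>: "probability_on S \<mu>" and \<nu>: "probability_on S \<nu>"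
  shows "(hellinger S \<mu> \<nu>)\<^sup>2 = 1 - affinity S \<mu> \<nu>"
proof -
  have "((\<lambda>y. \<mu> y + \<nu> y + (- 2) * sqrt (\<mu> y * \<nu> y)) has_sum 1 + 1 + (- 2) * affinity S \<mu> \<nu>) S"
    using affinity_summable[OF assms] \<mu> \<nu>
    by (intro has_sum_add has_sum_cmult_right) (auto simp: probability_on_def affinity_def)
  moreover have "\<mu> y + \<nu> y + (- 2) * sqrt (\<mu> y * \<nu> y) = (sqrt (\<mu> y) - sqrt (\<nu> y))\<^sup>2" if "y \<in> S" for y
    using probability_on_bounds(1)[OF \<mu> that] probability_on_bounds(1)[OF \<nu> that]
    by (simp add: power2_diff real_sqrt_mult)
  ultimately have "((\<lambda>y. (sqrt (\<mu> y) - sqrt (\<nu> y))\<^sup>2) has_sum 2 - 2 * affinity S \<mu> \<nu>) S"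
    by (subst (asm) has_sum_cong) auto
  then have eq: "(\<Sum>\<^sub>\<infinity>y\<in>S. (sqrt (\<mu> y) - sqrt (\<nu> y))\<^sup>2) = 2 - 2 * affinity S \<mu> \<nu>"
    by (rule infsumI)
  moreover have "0 \<le> (\<Sum>\<^sub>\<infinity>y\<in>S. (sqrt (\<mu> y) - sqrt (\<nu> y))\<^sup>2)"
    by (rule infsum_nonneg) simp
  ultimately show ?thesis by (simp add: hellinger_def)
qed

lemma hellinger_nonneg: "0 \<le> hellinger S \<mu> \<nu>"
  unfolding hellinger_def by (intro real_sqrt_ge_zero mult_nonneg_nonneg infsum_nonneg) auto

lemma affinity_nonneg:
  assumes "probability_on S \<mu>" and "probability_on S \<nu>"
  shows "0 \<le> affinity S \<mu> \<nu>"
  unfolding affinity_def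
  by (intro infsum_nonneg real_sqrt_ge_zero mult_nonneg_nonneg probability_on_bounds(1)[OF assms(1)]
      probability_on_bounds(1)[OF assms(2)])

lemma hellinger_le_1:
  assumes "probability_on S \<mu>" and "probability_on S \<nu>"
  shows "hellinger S \<mu> \<nu> \<le> 1"
proof (rule power2_le_imp_le)
  show "(hellinger S \<mu> \<nu>)\<^sup>2 \<le> 1\<^sup>2"
    using affinity_nonneg[OF assms] hellinger_power2[OF assms] by simp
qed simp

lemma affinity_product_measure:
  assumes "finite I" and "\<And>i. i \<in> I \<Longrightarrow> probability_on (X i) (\<mu> i)"
    and "\<And>i. i \<in> I \<Longrightarrow> probability_on (X i) (\<nu> i)"
  shows "affinity (Pi\<^sub>E I X) (product_measure I \<mu>) (product_measure I \<nu>) =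
    (\<Prod>i\<in>I. affinity (X i) (\<mu> i) (\<nu> i))"
proof -
  have "(\<lambda>u. norm (sqrt (\<mu> i u * \<nu> i u))) summable_on X i" if "i \<in> I" for i
    using affinity_summable[OF assms(2,3)[OF that]]
    by (rule summable_on_iff_abs_summable_on_real[THEN iffD1])
  then have "infsum (\<lambda>y. \<Prod>i\<in>I. sqrt (\<mu> i (y i) * \<nu> i (y i))) (Pi\<^sub>E I X) =
      (\<Prod>i\<in>I. \<Sum>\<^sub>\<infinity>u\<in>X i. sqrt (\<mu> i u * \<nu> i u))"
    by (rule infsum_prod_PiE_abs[OF \<open>finite I\<close>])
  moreover have "sqrt (product_measure I \<mu> y * product_measure I \<nu> y) = (\<Prod>i\<in>I. sqrt (\<mu> i (y i) * \<nu> i (y i)))" for y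
    unfolding product_measure_def by (simp add: sqrt_prod[OF \<open>finite I\<close>] flip: prod.distrib)
  ultimately show ?thesis by (simp add: affinity_def)
qed

lemma hellinger_dist_bounds:
  assumes "stochastic S K" "probability_on S \<pi>" "probability_on S \<mu>" "0 \<le> t"
  shows "0 \<le> hellinger_dist S K \<pi> \<mu> t" "hellinger_dist S K \<pi> \<mu> t \<le> 1"
  unfolding hellinger_dist_def
  by (intro hellinger_nonneg hellinger_le_1 probability_on_vec_mult stochastic_heat_kernel assms)+

text \<open>
  The law of the product chain at time \<open>t\<close> is the product of the laws of its coordinates, and the
  affinity of product measures is the product of the affinities.
\<close>

lemma hellinger_dist_product:
  assumes I: "finite I" "I \<noteq> {}" and p: "\<And>i. i \<in> I \<Longrightarrow> 0 < p i"
    and K: "\<And>i. i \<in> I \<Longrightarrow> stochastic (X i) (K i)"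
    and \<pi>: "\<And>i. i \<in> I \<Longrightarrow> probability_on (X i) (\<pi> i)"
    and \<mu>: "\<And>i. i \<in> I \<Longrightarrow> probability_on (X i) (\<mu> i)"
    and "0 \<le> t"
  shows "1 - (hellinger_dist (Pi\<^sub>E I X) (product_kernel I p K) (product_measure I \<pi>) (product_measure I \<mu>) t)\<^sup>2 =
    (\<Prod>i\<in>I. 1 - (hellinger_dist (X i) (K i) (\<pi> i) (\<mu> i) (p i * t / sum p I))\<^sup>2)"
proof -
  let ?\<nu> = "\<lambda>i. vec_mult (X i) (\<mu> i) (heat_kernel (X i) (K i) (p i * t / sum p I))"
  have "0 < sum p I" using I p by (rule sum_pos)
  then have t: "0 \<le> p i * t / sum p I" if "i \<in> I" for i
    using p[OF that] \<open>0 \<le> t\<close> by (simp add: less_imp_le)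
  have \<nu>: "probability_on (X i) (?\<nu> i)" if "i \<in> I" for i
    using that by (intro probability_on_vec_mult stochastic_heat_kernel \<mu> K t)
  have "hellinger_dist (Pi\<^sub>E I X) (product_kernel I p K) (product_measure I \<pi>) (product_measure I \<mu>) t =
      hellinger (Pi\<^sub>E I X) (product_measure I ?\<nu>) (product_measure I \<pi>)"
    unfolding hellinger_dist_def hellinger_def
    by (subst infsum_cong[OF arg_cong[where f = "\<lambda>v. (sqrt v - _)\<^sup>2", OF vec_mult_heat_kernel_product]])
      (use I p K \<mu> \<open>0 \<le> t\<close> in auto)
  also have "1 - \<dots>\<^sup>2 = affinity (Pi\<^sub>E I X) (product_measure I ?\<nu>) (product_measure I \<pi>)"
    by (simp add: hellinger_power2 probability_on_product_measure[OF \<open>finite I\<close>] \<nu> \<pi>)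
  also have "\<dots> = (\<Prod>i\<in>I. affinity (X i) (?\<nu> i) (\<pi> i))"
    by (rule affinity_product_measure[OF \<open>finite I\<close> \<nu> \<pi>])
  also have "\<dots> = (\<Prod>i\<in>I. 1 - (hellinger_dist (X i) (K i) (\<pi> i) (\<mu> i) (p i * t / sum p I))\<^sup>2)"
    unfolding hellinger_dist_def by (intro prod.cong refl) (simp add: hellinger_power2 \<nu> \<pi>)
  finally show ?thesis .
qed

section \<open>Comparing the distance with the square ratio and the maximum\<close>

lemma prod_one_minus_le_exp:
  fixes x :: "'i \<Rightarrow> real"
  assumes "finite I" "\<And>i. i \<in> I \<Longrightarrow> x i \<le> 1"
  shows "(\<Prod>i\<in>I. 1 - x i) \<le> exp (- (\<Sum>i\<in>I. x i))"
proof -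
  have "(\<Prod>i\<in>I. 1 - x i) \<le> (\<Prod>i\<in>I. exp (- x i))"
  proof (rule prod_mono)
    fix i assume "i \<in> I"
    then show "0 \<le> 1 - x i \<and> 1 - x i \<le> exp (- x i)"
      using assms(2) exp_ge_add_one_self[of "- x i"] by auto
  qed
  also have "\<dots> = exp (- (\<Sum>i\<in>I. x i))"
    using assms(1) by (simp add: exp_sum sum_negf[symmetric])
  finally show ?thesis .
qed

text \<open>
  Each factor satisfies \<open>1 / (1 - x) = 1 + x / (1 - x) \<le> exp (x / (1 - m))\<close>.
\<close>

lemma exp_le_prod_one_minus:
  fixes x :: "'i \<Rightarrow> real"
  assumes "finite I" "m < 1" "\<And>i. i \<in> I \<Longrightarrow> 0 \<le> x i" "\<And>i. i \<in> I \<Longrightarrow> x i \<le> m"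
  shows "exp (- ((\<Sum>i\<in>I. x i) / (1 - m))) \<le> (\<Prod>i\<in>I. 1 - x i)"
proof -
  have "exp (- (x i / (1 - m))) \<le> 1 - x i" if "i \<in> I" for i
  proof -
    have x: "0 \<le> x i" "x i \<le> m" using assms that by auto
    then have "1 / (1 - x i) = 1 + x i / (1 - x i)" using assms(2) by (simp add: field_simps)
    also have "\<dots> \<le> 1 + x i / (1 - m)"
      using x assms(2) by (intro add_left_mono divide_left_mono) auto
    also have "\<dots> \<le> exp (x i / (1 - m))" by (rule exp_ge_add_one_self)
    finally have "1 / exp (x i / (1 - m)) \<le> 1 - x i"
      using x assms(2) by (simp add: field_simps)
    then show ?thesis by (simp add: exp_minus inverse_eq_divide)
  qed
  then have "(\<Prod>i\<in>I. exp (- (x i / (1 - m)))) \<le> (\<Prod>i\<in>I. 1 - x i)"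
    by (intro prod_mono) auto
  also have "(\<Prod>i\<in>I. exp (- (x i / (1 - m)))) = exp (- ((\<Sum>i\<in>I. x i) / (1 - m)))"
    using assms(1) by (simp add: exp_sum[symmetric] sum_negf sum_divide_distrib)
  finally show ?thesis .
qed

lemma prod_one_minus_le_factor:
  fixes x :: "'i \<Rightarrow> real"
  assumes "finite I" "\<And>i. i \<in> I \<Longrightarrow> 0 \<le> x i \<and> x i \<le> 1" "i \<in> I"
  shows "(\<Prod>i\<in>I. 1 - x i) \<le> 1 - x i"
proof -
  have "(\<Prod>i\<in>I. 1 - x i) = (1 - x i) * (\<Prod>j\<in>I - {i}. 1 - x j)"
    using assms by (intro prod.remove)
  also have "\<dots> \<le> 1 - x i"
    using assms by (intro mult_left_le prod_le_1) auto
  finally show ?thesis .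
qed

text \<open>
  The shape of \<open>F_fun\<close> for one \<open>n\<close> and one time.
\<close>

definition square_ratio :: "'i set \<Rightarrow> ('i \<Rightarrow> real) \<Rightarrow> ereal" where
  "square_ratio I d = ereal (\<Sum>i\<in>I. (d i)\<^sup>2) / ereal (1 - Max ((\<lambda>i. (d i)\<^sup>2) ` I))"

context
  fixes I :: "'i set" and d :: "'i \<Rightarrow> real" and D :: real
  assumes I: "finite I" "I \<noteq> {}"
    and d: "\<And>i. i \<in> I \<Longrightarrow> 0 \<le> d i" "\<And>i. i \<in> I \<Longrightarrow> d i \<le> 1"
    and D: "0 \<le> D"
    and prod: "1 - D\<^sup>2 = (\<Prod>i\<in>I. 1 - (d i)\<^sup>2)"
begin

lemma square_le_1: "i \<in> I \<Longrightarrow> 0 \<le> (d i)\<^sup>2 \<and> (d i)\<^sup>2 \<le> 1"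
  using d by (simp add: power_le_one)

lemma Max_square_bounds: "Max ((\<lambda>i. (d i)\<^sup>2) ` I) \<le> D\<^sup>2" "\<And>i. i \<in> I \<Longrightarrow> (d i)\<^sup>2 \<le> Max ((\<lambda>i. (d i)\<^sup>2) ` I)"
proof -
  have "(d i)\<^sup>2 \<le> D\<^sup>2" if "i \<in> I" for i
    using prod_one_minus_le_factor[of I "\<lambda>i. (d i)\<^sup>2" i] I square_le_1 that prod by simp
  then show "Max ((\<lambda>i. (d i)\<^sup>2) ` I) \<le> D\<^sup>2" using I by simp
qed (use I in simp)

lemma square_ratio_nonneg: "0 \<le> square_ratio I d"
proof -
  have "Max ((\<lambda>i. (d i)\<^sup>2) ` I) \<le> 1" using I square_le_1 by simp
  then show ?thesis
    unfolding square_ratio_def by (intro zero_le_divide_ereal) (auto intro!: sum_nonneg)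
qed

text \<open>
  The upper bound \<open>exp (- s)\<close> for \<open>1 - D\<^sup>2\<close> gives \<open>s \<le> D\<^sup>2 / (1 - D\<^sup>2)\<close> for the sum \<open>s\<close> of the
  squares; the denominator is at least \<open>1 - D\<^sup>2\<close> because \<open>D\<close> dominates every \<open>d i\<close>.
\<close>

lemma square_ratio_le:
  assumes "D < 1"
  shows "square_ratio I d \<le> ereal (D\<^sup>2 / (1 - D\<^sup>2)\<^sup>2)"
proof -
  let ?s = "\<Sum>i\<in>I. (d i)\<^sup>2" and ?m = "Max ((\<lambda>i. (d i)\<^sup>2) ` I)"
  have pos: "0 < 1 - D\<^sup>2" using D assms by (simp add: power_less_one_iff abs_square_less_1)
  then have m: "1 - D\<^sup>2 \<le> 1 - ?m" using Max_square_bounds(1) by simp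
  have "1 - D\<^sup>2 \<le> exp (- ?s)"
    using prod_one_minus_le_exp[of I "\<lambda>i. (d i)\<^sup>2"] I square_le_1 by (simp add: prod)
  then have "exp ?s \<le> 1 / (1 - D\<^sup>2)"
    using pos by (simp add: exp_minus field_simps)
  moreover have "1 + ?s \<le> exp ?s" by (rule exp_ge_add_one_self)
  ultimately have "?s \<le> 1 / (1 - D\<^sup>2) - 1" by linarith
  also have "\<dots> = D\<^sup>2 / (1 - D\<^sup>2)" using pos by (simp add: field_simps)
  finally have "?s / (1 - ?m) \<le> D\<^sup>2 / (1 - D\<^sup>2) / (1 - D\<^sup>2)"
    using pos m by (intro frac_le) auto
  also have "\<dots> = D\<^sup>2 / (1 - D\<^sup>2)\<^sup>2" by (simp add: power2_eq_square[of "1 - D\<^sup>2"])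
  finally have "?s / (1 - ?m) \<le> D\<^sup>2 / (1 - D\<^sup>2)\<^sup>2" .
  moreover have "square_ratio I d = ereal (?s / (1 - ?m))"
    using pos m by (simp add: square_ratio_def)
  ultimately show ?thesis by simp
qed

text \<open>
  A finite ratio forces the maximum below 1, and then \<open>exp_le_prod_one_minus\<close> applies with
  that maximum as \<open>m\<close>.  For small \<open>r\<close> this bounds \<open>D\<^sup>2\<close> by about \<open>r\<close>, and for every \<open>r\<close> it keeps
  \<open>D\<close> away from 1.
\<close>

lemma le_of_square_ratio_le:
  assumes "square_ratio I d \<le> ereal r"
  shows "D\<^sup>2 \<le> 1 - exp (- r)"
proof -
  let ?s = "\<Sum>i\<in>I. (d i)\<^sup>2" and ?m = "Max ((\<lambda>i. (d i)\<^sup>2) ` I)"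
  have "?m \<in> (\<lambda>i. (d i)\<^sup>2) ` I" using I by (intro Max_in) auto
  then obtain i where i: "i \<in> I" "?m = (d i)\<^sup>2" by blast
  have "?m \<noteq> 1"
  proof
    assume m: "?m = 1"
    have "?m \<le> ?s" unfolding i(2) using I i(1) by (intro member_le_sum) auto
    then have "square_ratio I d = \<infinity>"
      by (simp add: square_ratio_def m divide_ereal_def)
    with assms show False by simp
  qed
  moreover have "?m \<le> 1" using i square_le_1 by simp
  ultimately have m: "?m < 1" by simp
  have "?s / (1 - ?m) \<le> r"
    using assms m by (simp add: square_ratio_def)
  then have "exp (- r) \<le> exp (- (?s / (1 - ?m)))" by simp
  also have "\<dots> \<le> (\<Prod>i\<in>I. 1 - (d i)\<^sup>2)"
    using I m Max_square_bounds(2) by (intro exp_le_prod_one_minus) auto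
  finally show ?thesis using prod by simp
qed

lemma Max_le: "Max (d ` I) \<le> D"
proof -
  have "d i \<le> D" if "i \<in> I" for i
    by (rule power2_le_imp_le[OF order_trans[OF Max_square_bounds(2)[OF that] Max_square_bounds(1)] D])
  then show ?thesis using I by simp
qed

text \<open>
  Each of the at most \<open>N\<close> factors of \<open>1 - D\<^sup>2\<close> is at least \<open>1 - r\<^sup>2\<close>.
\<close>

lemma power2_le_of_Max_le:
  assumes "Max (d ` I) \<le> r" "r \<le> 1" "card I \<le> N"
  shows "D\<^sup>2 \<le> 1 - (1 - r\<^sup>2) ^ N"
proof -
  have le: "d i \<le> r" if "i \<in> I" for i
    using assms(1) I that by (meson Max_ge finite_imageI image_eqI order_trans)
  then have r: "0 \<le> r" using I d by (meson ex_in_conv order_trans)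
  have "(1 - r\<^sup>2) ^ N \<le> (1 - r\<^sup>2) ^ card I"
    using r assms by (intro power_decreasing) (auto simp: power_le_one)
  also have "\<dots> = (\<Prod>i\<in>I. 1 - r\<^sup>2)" by simp
  also have "\<dots> \<le> (\<Prod>i\<in>I. 1 - (d i)\<^sup>2)"
    using le d r assms(2) by (intro prod_mono) (auto simp: power_le_one power_mono)
  finally show ?thesis using prod by simp
qed

end

section \<open>Transfer of limits\<close>

text \<open>
  A limit of \<open>f\<close> at either end of its range \<open>[0, L]\<close> forces the corresponding limit of \<open>g\<close> in
  \<open>[0, M]\<close>.  Uniformity in \<open>n\<close> and \<open>t\<close> lets one \<open>\<delta>\<close> serve for all \<open>c\<close> in the iterated limits of a
  window cutoff; negative times are left out because distances are controlled only after time 0.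
\<close>

definition limit_transfer ::
  "(nat \<Rightarrow> real \<Rightarrow> ereal) \<Rightarrow> ereal \<Rightarrow> (nat \<Rightarrow> real \<Rightarrow> ereal) \<Rightarrow> ereal \<Rightarrow> bool" where
  "limit_transfer f L g M \<longleftrightarrow>
     (\<forall>e>0. \<exists>\<delta>>0. \<forall>n\<ge>1. \<forall>t\<ge>0. f n t < ereal \<delta> \<longrightarrow> g n t < ereal e) \<and>
     (\<forall>c. ereal c < M \<longrightarrow> (\<exists>b. ereal b < L \<and> (\<forall>n\<ge>1. \<forall>t\<ge>0. ereal b < f n t \<longrightarrow> ereal c < g n t))) \<and>
     (\<forall>n\<ge>1. \<forall>t\<ge>0. 0 \<le> g n t \<and> g n t \<le> M)"

definition cutoff_limits :: "(nat \<Rightarrow> real \<Rightarrow> ereal) \<Rightarrow> ereal \<Rightarrow> (nat \<Rightarrow> real) \<Rightarrow> bool" where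
  "cutoff_limits f L t \<longleftrightarrow>
     (\<forall>a>1. (\<lambda>n. f n (a * t n)) \<longlonglongrightarrow> 0) \<and>
     (\<forall>a. 0 < a \<and> a < 1 \<longrightarrow> (\<lambda>n. f n (a * t n)) \<longlonglongrightarrow> L)"

definition window_limits ::
  "(nat \<Rightarrow> real \<Rightarrow> ereal) \<Rightarrow> ereal \<Rightarrow> (nat \<Rightarrow> real) \<Rightarrow> (nat \<Rightarrow> real) \<Rightarrow> bool" where
  "window_limits f L t b \<longleftrightarrow>
     ((\<lambda>c. limsup (\<lambda>n. f n (t n + c * b n))) \<longlongrightarrow> 0) at_top \<and>
     ((\<lambda>c. liminf (\<lambda>n. f n (t n + c * b n))) \<longlongrightarrow> L) at_bot"

lemma eventually_region:
  assumes "eventually (\<lambda>n. 0 \<le> s n) sequentially" "\<And>n t. 1 \<le> n \<Longrightarrow> 0 \<le> t \<Longrightarrow> P n (t :: real)"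
  shows "eventually (\<lambda>n. P n (s n)) sequentially"
  using assms(1) eventually_ge_at_top[of 1] by eventually_elim (rule assms(2))

lemma limit_transfer_lowE:
  assumes "limit_transfer f L g M" "0 < (e :: ereal)"
  obtains \<delta> where "0 < \<delta>" "\<And>n t. 1 \<le> n \<Longrightarrow> 0 \<le> t \<Longrightarrow> f n t < \<delta> \<Longrightarrow> g n t < e"
proof -
  obtain r where r: "0 < ereal r" "ereal r < e" using ereal_dense2[OF assms(2)] by blast
  then have "0 < r" by simp
  then obtain \<delta> where \<delta>: "\<delta> > 0" "\<forall>n\<ge>1. \<forall>t\<ge>0. f n t < ereal \<delta> \<longrightarrow> g n t < ereal r"
    using assms(1) unfolding limit_transfer_def by blast
  show thesis
  proof
    show "0 < ereal \<delta>" using \<delta>(1) by simp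
    show "g n t < e" if "1 \<le> n" "0 \<le> t" "f n t < ereal \<delta>" for n t
      using \<delta>(2) that r(2) less_trans by blast
  qed
qed

lemma limit_transfer_highE:
  assumes "limit_transfer f L g M" "c < M"
  obtains b where "b < L" "\<And>n t. 1 \<le> n \<Longrightarrow> 0 \<le> t \<Longrightarrow> b < f n t \<Longrightarrow> c < g n t"
proof -
  obtain r where r: "c < ereal r" "ereal r < M" using ereal_dense2[OF assms(2)] by blast
  then obtain b where b: "ereal b < L" "\<forall>n\<ge>1. \<forall>t\<ge>0. ereal b < f n t \<longrightarrow> ereal r < g n t"
    using assms(1) unfolding limit_transfer_def by blast
  show thesis
  proof
    show "ereal b < L" by (rule b(1))
    show "c < g n t" if "1 \<le> n" "0 \<le> t" "ereal b < f n t" for n t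
      using b(2) that r(1) less_trans by blast
  qed
qed

lemma limit_transfer_bounds:
  assumes "limit_transfer f L g M" "1 \<le> n" "0 \<le> t"
  shows "0 \<le> g n t" "g n t \<le> M"
  using assms unfolding limit_transfer_def by blast+

lemma cutoff_limits_transfer:
  assumes tr: "limit_transfer f L g M" and t: "\<forall>n\<ge>1. 0 < t n" and f: "cutoff_limits f L t"
  shows "cutoff_limits g M t"
proof -
  have s: "eventually (\<lambda>n. 0 \<le> a * t n) sequentially" if "0 < a" for a
    using t that by (intro eventually_sequentiallyI[of 1]) (simp add: less_imp_le)
  show ?thesis
    unfolding cutoff_limits_def
  proof (intro conjI allI impI)
    fix a :: real assume a: "1 < a"
    then have lim: "(\<lambda>n. f n (a * t n)) \<longlonglongrightarrow> 0" using f by (simp add: cutoff_limits_def)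
    note ev = eventually_region[OF s[of a]]
    show "(\<lambda>n. g n (a * t n)) \<longlonglongrightarrow> 0"
    proof (rule order_tendstoI)
      fix e :: ereal assume "e < 0"
      then show "eventually (\<lambda>n. e < g n (a * t n)) sequentially"
        using a limit_transfer_bounds(1)[OF tr] by (intro ev) (auto intro: less_le_trans)
    next
      fix e :: ereal assume "0 < e"
      then obtain \<delta> where \<delta>: "0 < \<delta>"
        "\<And>n t. 1 \<le> n \<Longrightarrow> 0 \<le> t \<Longrightarrow> f n t < \<delta> \<Longrightarrow> g n t < e"
        using limit_transfer_lowE[OF tr] by metis
      have "eventually (\<lambda>n. f n (a * t n) < \<delta> \<longrightarrow> g n (a * t n) < e) sequentially"
        using a \<delta>(2) by (intro ev) auto
      with order_tendstoD(2)[OF lim \<delta>(1)] show "eventually (\<lambda>n. g n (a * t n) < e) sequentially"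
        by eventually_elim simp
    qed
  next
    fix a :: real assume a: "0 < a \<and> a < 1"
    then have lim: "(\<lambda>n. f n (a * t n)) \<longlonglongrightarrow> L" using f by (simp add: cutoff_limits_def)
    note ev = eventually_region[OF s[of a]]
    show "(\<lambda>n. g n (a * t n)) \<longlonglongrightarrow> M"
    proof (rule order_tendstoI)
      fix c assume "M < c"
      then show "eventually (\<lambda>n. g n (a * t n) < c) sequentially"
        using a limit_transfer_bounds(2)[OF tr] by (intro ev) (auto intro: le_less_trans)
    next
      fix c assume "c < M"
      then obtain b where b: "b < L"
        "\<And>n t. 1 \<le> n \<Longrightarrow> 0 \<le> t \<Longrightarrow> b < f n t \<Longrightarrow> c < g n t"
        using limit_transfer_highE[OF tr] by metis
      have "eventually (\<lambda>n. b < f n (a * t n) \<longrightarrow> c < g n (a * t n)) sequentially"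
        using a b(2) by (intro ev) auto
      with order_tendstoD(1)[OF lim b(1)] show "eventually (\<lambda>n. c < g n (a * t n)) sequentially"
        by eventually_elim simp
    qed
  qed
qed

text \<open>
  The comparison of distances holds for nonnegative times only; this places the times of a window
  in that region for large \<open>n\<close>.
\<close>

lemma eventually_window_nonneg:
  fixes t b :: "nat \<Rightarrow> real"
  assumes "\<forall>n\<ge>1. 0 < t n" "\<forall>n\<ge>1. 0 < b n" "b \<in> o(t)"
  shows "eventually (\<lambda>n. 0 \<le> t n + c * b n) sequentially"
proof -
  have "0 < 1 / (\<bar>c\<bar> + 1)" by simp
  from landau_o.smallD[OF assms(3) this]
  have "eventually (\<lambda>n. norm (b n) \<le> 1 / (\<bar>c\<bar> + 1) * norm (t n)) sequentially" .
  then show ?thesis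
    using eventually_ge_at_top[of 1]
  proof eventually_elim
    case (elim n)
    then have pos: "0 < t n" "0 < b n" using assms by auto
    have "\<bar>c\<bar> * b n \<le> (\<bar>c\<bar> + 1) * b n" using pos by (simp add: algebra_simps)
    also have "\<dots> \<le> t n" using elim pos by (simp add: field_simps)
    finally have "\<bar>c * b n\<bar> \<le> t n" using pos by (simp add: abs_mult)
    then show ?case by linarith
  qed
qed

text \<open>
  A strict inequality for a limes superior or inferior over \<open>n\<close> holds for almost all \<open>n\<close>, where the
  comparison applies.  It yields a weak inequality in the limit, so the target \<open>e\<close> is first
  replaced by an intermediate \<open>e'\<close>.
\<close>

lemma window_limits_transfer:
  assumes tr: "limit_transfer f L g M" and s: "\<And>c. eventually (\<lambda>n. 0 \<le> t n + c * b n) sequentially"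
    and f: "window_limits f L t b"
  shows "window_limits g M t b"
  unfolding window_limits_def
proof
  note ev = eventually_region[OF s]
  let ?f = "\<lambda>c. limsup (\<lambda>n. f n (t n + c * b n))" and ?g = "\<lambda>c. limsup (\<lambda>n. g n (t n + c * b n))"
  have lim: "(?f \<longlongrightarrow> 0) at_top" using f by (simp add: window_limits_def)
  show "(?g \<longlongrightarrow> 0) at_top"
  proof (rule order_tendstoI)
    fix e :: ereal assume "e < 0"
    moreover have "0 \<le> ?g c" for c
      using limit_transfer_bounds(1)[OF tr] by (intro le_Limsup ev) auto
    ultimately show "eventually (\<lambda>c. e < ?g c) at_top"
      by (intro always_eventually allI) (rule less_le_trans)
  next
    fix e :: ereal assume "0 < e"
    then obtain e' where e': "0 < e'" "e' < e" using dense by blast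
    then obtain \<delta> where \<delta>: "0 < \<delta>"
      "\<And>n t. 1 \<le> n \<Longrightarrow> 0 \<le> t \<Longrightarrow> f n t < \<delta> \<Longrightarrow> g n t < e'"
      using limit_transfer_lowE[OF tr] by metis
    from order_tendstoD(2)[OF lim \<delta>(1)] show "eventually (\<lambda>c. ?g c < e) at_top"
    proof eventually_elim
      case (elim c)
      have "eventually (\<lambda>n. f n (t n + c * b n) < \<delta> \<longrightarrow> g n (t n + c * b n) < e') sequentially"
        using \<delta>(2) by (intro ev) auto
      with Limsup_lessD[OF elim] have "eventually (\<lambda>n. g n (t n + c * b n) \<le> e') sequentially"
        by eventually_elim simp
      then have "?g c \<le> e'" by (rule Limsup_bounded)
      then show ?case using e'(2) by (rule le_less_trans)
    qed
  qed
next
  note ev = eventually_region[OF s]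
  let ?f = "\<lambda>c. liminf (\<lambda>n. f n (t n + c * b n))" and ?g = "\<lambda>c. liminf (\<lambda>n. g n (t n + c * b n))"
  have lim: "(?f \<longlongrightarrow> L) at_bot" using f by (simp add: window_limits_def)
  show "(?g \<longlongrightarrow> M) at_bot"
  proof (rule order_tendstoI)
    fix e assume "M < e"
    moreover have "?g c \<le> M" for c
      using limit_transfer_bounds(2)[OF tr] by (intro Liminf_le ev) auto
    ultimately show "eventually (\<lambda>c. ?g c < e) at_bot"
      by (intro always_eventually allI) (auto intro: le_less_trans)
  next
    fix e assume "e < M"
    then obtain e' where e': "e < e'" "e' < M" using dense by blast
    then obtain a where a: "a < L"
      "\<And>n t. 1 \<le> n \<Longrightarrow> 0 \<le> t \<Longrightarrow> a < f n t \<Longrightarrow> e' < g n t"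
      using limit_transfer_highE[OF tr] by metis
    from order_tendstoD(1)[OF lim a(1)] show "eventually (\<lambda>c. e < ?g c) at_bot"
    proof eventually_elim
      case (elim c)
      have "eventually (\<lambda>n. a < f n (t n + c * b n) \<longrightarrow> e' < g n (t n + c * b n)) sequentially"
        using a(2) by (intro ev) auto
      with less_LiminfD[OF elim] have "eventually (\<lambda>n. e' \<le> g n (t n + c * b n)) sequentially"
        by eventually_elim simp
      then have "e' \<le> ?g c" by (rule Liminf_bounded)
      with e'(1) show ?case by (rule less_le_trans)
    qed
  qed
qed

lemma hellinger_cutoff_iff:
  "hellinger_cutoff S K \<pi> \<mu> t \<longleftrightarrow> (\<forall>n\<ge>1. 0 < t n) \<and>
    cutoff_limits (\<lambda>n s. ereal (hellinger_dist (S n) (K n) (\<pi> n) (\<mu> n) s)) 1 t"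
  by (simp add: hellinger_cutoff_def cutoff_limits_def zero_ereal_def one_ereal_def)

lemma hellinger_window_cutoff_iff:
  "hellinger_window_cutoff S K \<pi> \<mu> t b \<longleftrightarrow>
    (\<forall>n\<ge>1. 0 < t n) \<and> (\<forall>n\<ge>1. 0 < b n) \<and> b \<in> o(t) \<and>
    window_limits (\<lambda>n s. ereal (hellinger_dist (S n) (K n) (\<pi> n) (\<mu> n) s)) 1 t b"
  by (simp add: hellinger_window_cutoff_def window_limits_def)

text \<open>
  All four implications come from the two bounds
  \<open>F \<le> D\<^sup>2 / (1 - D\<^sup>2)\<^sup>2\<close> and \<open>D\<^sup>2 \<le> 1 - exp (- F)\<close>.
\<close>

lemma square_ratio_transfer:
  fixes d :: "nat \<Rightarrow> real \<Rightarrow> 'i \<Rightarrow> real" and D :: "nat \<Rightarrow> real \<Rightarrow> real"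
  assumes I: "\<And>n. 1 \<le> n \<Longrightarrow> finite (I n)" "\<And>n. 1 \<le> n \<Longrightarrow> I n \<noteq> {}"
    and d: "\<And>n t i. 1 \<le> n \<Longrightarrow> 0 \<le> t \<Longrightarrow> i \<in> I n \<Longrightarrow> 0 \<le> d n t i"
      "\<And>n t i. 1 \<le> n \<Longrightarrow> 0 \<le> t \<Longrightarrow> i \<in> I n \<Longrightarrow> d n t i \<le> 1"
    and D: "\<And>n t. 1 \<le> n \<Longrightarrow> 0 \<le> t \<Longrightarrow> 0 \<le> D n t" "\<And>n t. 1 \<le> n \<Longrightarrow> 0 \<le> t \<Longrightarrow> D n t \<le> 1"
    and prod: "\<And>n t. 1 \<le> n \<Longrightarrow> 0 \<le> t \<Longrightarrow> 1 - (D n t)\<^sup>2 = (\<Prod>i\<in>I n. 1 - (d n t i)\<^sup>2)"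
  shows "limit_transfer (\<lambda>n t. ereal (D n t)) 1 (\<lambda>n t. square_ratio (I n) (d n t)) \<infinity>"
    and "limit_transfer (\<lambda>n t. square_ratio (I n) (d n t)) \<infinity> (\<lambda>n t. ereal (D n t)) 1"
proof -
  let ?F = "\<lambda>n t. square_ratio (I n) (d n t)"
  have up: "?F n t \<le> ereal ((D n t)\<^sup>2 / (1 - (D n t)\<^sup>2)\<^sup>2)" if "1 \<le> n" "0 \<le> t" "D n t < 1" for n t
    using that I d D(1) prod by (intro square_ratio_le)
  have up': "?F n t \<le> ereal (r\<^sup>2 / (1 - r\<^sup>2)\<^sup>2)" if "1 \<le> n" "0 \<le> t" "D n t \<le> r" "r < 1" for n t r
  proof -
    have sq: "(D n t)\<^sup>2 \<le> r\<^sup>2" "r\<^sup>2 < 1"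
      using that D(1)[of n t] by (auto simp: power_mono abs_square_less_1)
    then have "(1 - r\<^sup>2)\<^sup>2 \<le> (1 - (D n t)\<^sup>2)\<^sup>2"
      by (intro power_mono) auto
    with sq have "(D n t)\<^sup>2 / (1 - (D n t)\<^sup>2)\<^sup>2 \<le> r\<^sup>2 / (1 - r\<^sup>2)\<^sup>2"
      by (intro frac_le) auto
    with up[of n t] that show ?thesis by (auto intro: order_trans)
  qed
  have low: "(D n t)\<^sup>2 \<le> 1 - exp (- r)" if "1 \<le> n" "0 \<le> t" "?F n t \<le> ereal r" for n t r
    using that I d D(1) prod by (intro le_of_square_ratio_le[of "I n" "d n t"])
  have nonneg: "0 \<le> ?F n t" if "1 \<le> n" "0 \<le> t" for n t
    using that I d D(1) prod by (intro square_ratio_nonneg[of "I n" "d n t" "D n t"])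
  show "limit_transfer (\<lambda>n t. ereal (D n t)) 1 ?F \<infinity>"
    unfolding limit_transfer_def
  proof (intro conjI allI impI)
    fix e :: real assume "0 < e"
    show "\<exists>\<delta>>0. \<forall>n\<ge>1. \<forall>t\<ge>0. ereal (D n t) < ereal \<delta> \<longrightarrow> ?F n t < ereal e"
    \<comment> \<open>For \<open>D \<le> 1 / 2\<close> the first bound is at most \<open>D\<close> itself.\<close>
    proof (intro exI[of _ "min (1 / 2) e"] conjI allI impI)
      fix n :: nat and t :: real
      assume nt: "1 \<le> n" "0 \<le> t" and "ereal (D n t) < ereal (min (1 / 2) e)"
      then have less: "D n t \<le> 1 / 2" "D n t < e" by auto
      let ?y = "(D n t)\<^sup>2"
      have "?y \<le> D n t / 2"
        using mult_left_mono[OF less(1) D(1)[OF nt]] by (simp add: power2_eq_square)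
      moreover from this have "(3 / 4)\<^sup>2 \<le> (1 - ?y)\<^sup>2"
        using less(1) by (intro power_mono) auto
      then have "1 / 2 \<le> (1 - ?y)\<^sup>2"
        by (simp add: power2_eq_square[of "3 / 4 :: real"])
      ultimately have "?y / (1 - ?y)\<^sup>2 \<le> (D n t / 2) / (1 / 2)"
        using D(1)[OF nt] by (intro frac_le) auto
      then show "?F n t < ereal e"
        using up[OF nt] less by (auto intro: le_less_trans)
    qed (use \<open>0 < e\<close> in auto)
  next
    fix c :: real
    show "\<exists>b. ereal b < 1 \<and> (\<forall>n\<ge>1. \<forall>t\<ge>0. ereal b < ereal (D n t) \<longrightarrow> ereal c < ?F n t)"
    proof (intro exI[of _ "sqrt (1 - exp (- max c 0))"] conjI allI impI)
      show "ereal (sqrt (1 - exp (- max c 0))) < 1" by simp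
      fix n :: nat and t :: real
      assume nt: "1 \<le> n" "0 \<le> t" and less: "ereal (sqrt (1 - exp (- max c 0))) < ereal (D n t)"
      show "ereal c < ?F n t"
      proof (rule ccontr)
        assume "\<not> ereal c < ?F n t"
        then have "?F n t \<le> ereal c" by simp
        also have "\<dots> \<le> ereal (max c 0)" by simp
        finally have "D n t \<le> sqrt (1 - exp (- max c 0))"
          using low[OF nt] by (intro real_le_rsqrt)
        with less show False by simp
      qed
    qed
  qed (use nonneg in auto)
  show "limit_transfer ?F \<infinity> (\<lambda>n t. ereal (D n t)) 1"
    unfolding limit_transfer_def
  proof (intro conjI allI impI)
    fix e :: real assume "0 < e"
    show "\<exists>\<delta>>0. \<forall>n\<ge>1. \<forall>t\<ge>0. ?F n t < ereal \<delta> \<longrightarrow> ereal (D n t) < ereal e"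
    proof (intro exI[of _ "e\<^sup>2 / 2"] conjI allI impI)
      fix n :: nat and t :: real
      assume nt: "1 \<le> n" "0 \<le> t" and "?F n t < ereal (e\<^sup>2 / 2)"
      then have "(D n t)\<^sup>2 \<le> 1 - exp (- (e\<^sup>2 / 2))" by (intro low) auto
      also have "\<dots> \<le> e\<^sup>2 / 2" using exp_ge_add_one_self[of "- (e\<^sup>2 / 2)"] by linarith
      also have "\<dots> < e\<^sup>2" using \<open>0 < e\<close> by simp
      finally show "ereal (D n t) < ereal e"
        using \<open>0 < e\<close> by (simp add: power_less_imp_less_base)
    qed (use \<open>0 < e\<close> in auto)
  next
    fix c :: real assume c: "ereal c < 1"
    let ?r = "max c 0"
    show "\<exists>b. ereal b < \<infinity> \<and> (\<forall>n\<ge>1. \<forall>t\<ge>0. ereal b < ?F n t \<longrightarrow> ereal c < ereal (D n t))"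
    proof (intro exI[of _ "?r\<^sup>2 / (1 - ?r\<^sup>2)\<^sup>2"] conjI allI impI)
      fix n :: nat and t :: real
      assume nt: "1 \<le> n" "0 \<le> t" and less: "ereal (?r\<^sup>2 / (1 - ?r\<^sup>2)\<^sup>2) < ?F n t"
      show "ereal c < ereal (D n t)"
      proof (rule ccontr)
        assume "\<not> ereal c < ereal (D n t)"
        then have "D n t \<le> ?r" "?r < 1" using c by auto
        from up'[OF nt this] less show False by simp
      qed
    qed simp
  qed (use D in auto)
qed

text \<open>
  Here the two bounds are \<open>G \<le> D\<close> and \<open>D\<^sup>2 \<le> 1 - (1 - G\<^sup>2) ^ N\<close> for the maximum \<open>G\<close>.
\<close>

lemma Max_transfer:
  fixes d :: "nat \<Rightarrow> real \<Rightarrow> 'i \<Rightarrow> real" and D :: "nat \<Rightarrow> real \<Rightarrow> real"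
  assumes I: "\<And>n. 1 \<le> n \<Longrightarrow> finite (I n)" "\<And>n. 1 \<le> n \<Longrightarrow> I n \<noteq> {}"
    and card: "\<And>n. 1 \<le> n \<Longrightarrow> card (I n) \<le> N"
    and d: "\<And>n t i. 1 \<le> n \<Longrightarrow> 0 \<le> t \<Longrightarrow> i \<in> I n \<Longrightarrow> 0 \<le> d n t i"
      "\<And>n t i. 1 \<le> n \<Longrightarrow> 0 \<le> t \<Longrightarrow> i \<in> I n \<Longrightarrow> d n t i \<le> 1"
    and D: "\<And>n t. 1 \<le> n \<Longrightarrow> 0 \<le> t \<Longrightarrow> 0 \<le> D n t" "\<And>n t. 1 \<le> n \<Longrightarrow> 0 \<le> t \<Longrightarrow> D n t \<le> 1"
    and prod: "\<And>n t. 1 \<le> n \<Longrightarrow> 0 \<le> t \<Longrightarrow> 1 - (D n t)\<^sup>2 = (\<Prod>i\<in>I n. 1 - (d n t i)\<^sup>2)"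
  shows "limit_transfer (\<lambda>n t. ereal (D n t)) 1 (\<lambda>n t. ereal (Max (d n t ` I n))) 1"
    and "limit_transfer (\<lambda>n t. ereal (Max (d n t ` I n))) 1 (\<lambda>n t. ereal (D n t)) 1"
proof -
  let ?G = "\<lambda>n t. Max (d n t ` I n)"
  have G_le: "?G n t \<le> D n t" if "1 \<le> n" "0 \<le> t" for n t
    using that I d D(1) prod by (intro Max_le)
  have G_nonneg: "0 \<le> ?G n t" if nt: "1 \<le> n" "0 \<le> t" for n t
  proof -
    obtain i where i: "i \<in> I n" using I(2)[OF nt(1)] by blast
    then have "d n t i \<le> ?G n t" using I(1)[OF nt(1)] by simp
    with d(1)[OF nt i] show ?thesis by simp
  qed
  have D_le: "(D n t)\<^sup>2 \<le> 1 - (1 - r\<^sup>2) ^ N" if "1 \<le> n" "0 \<le> t" "?G n t \<le> r" "r \<le> 1" for n t r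
    using that(1,2) by (intro power2_le_of_Max_le[of "I n" "d n t"] I d D(1) prod card that)
  show "limit_transfer (\<lambda>n t. ereal (D n t)) 1 (\<lambda>n t. ereal (?G n t)) 1"
    unfolding limit_transfer_def
  proof (intro conjI allI impI)
    fix e :: real assume "0 < e"
    then show "\<exists>\<delta>>0. \<forall>n\<ge>1. \<forall>t\<ge>0. ereal (D n t) < ereal \<delta> \<longrightarrow> ereal (?G n t) < ereal e"
      using G_le by (intro exI[of _ e]) (auto intro: le_less_trans)
  next
    fix c :: real assume c: "ereal c < 1"
    let ?r = "max c 0"
    let ?b = "sqrt (1 - (1 - ?r\<^sup>2) ^ N)"
    show "\<exists>b. ereal b < 1 \<and> (\<forall>n\<ge>1. \<forall>t\<ge>0. ereal b < ereal (D n t) \<longrightarrow> ereal c < ereal (?G n t))"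
    proof (intro exI[of _ ?b] conjI allI impI)
      have "0 < 1 - ?r\<^sup>2" using c by (simp add: abs_square_less_1)
      then show "ereal ?b < 1" by simp
      fix n :: nat and t :: real
      assume nt: "1 \<le> n" "0 \<le> t" and less: "ereal ?b < ereal (D n t)"
      show "ereal c < ereal (?G n t)"
      proof (rule ccontr)
        assume "\<not> ereal c < ereal (?G n t)"
        then have "?G n t \<le> ?r" "?r \<le> 1" using c by auto
        then have "D n t \<le> ?b" by (intro real_le_rsqrt D_le nt)
        with less show False by simp
      qed
    qed
  next
    fix n :: nat and t :: real assume nt: "1 \<le> n" "0 \<le> t"
    show "0 \<le> ereal (?G n t)" using G_nonneg[OF nt] by simp
    show "ereal (?G n t) \<le> 1" using G_le[OF nt] D(2)[OF nt] by simp
  qed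
  show "limit_transfer (\<lambda>n t. ereal (?G n t)) 1 (\<lambda>n t. ereal (D n t)) 1"
    unfolding limit_transfer_def
  proof (intro conjI allI impI)
    fix e :: real assume "0 < e"
    \<comment> \<open>Bernoulli gives \<open>D\<^sup>2 \<le> N * \<delta>\<^sup>2\<close>; \<open>N + 1\<close> makes the inequality strict and covers \<open>N = 0\<close>.\<close>
    define \<delta> where "\<delta> = min 1 (e / (real N + 1))"
    have \<delta>: "0 < \<delta>" "\<delta> \<le> 1" using \<open>0 < e\<close> by (auto simp: \<delta>_def)
    have "\<delta> \<le> e / (real N + 1)" by (simp add: \<delta>_def)
    then have \<delta>_e: "(real N + 1) * \<delta> \<le> e" by (simp add: pos_le_divide_eq mult.commute)
    show "\<exists>\<delta>>0. \<forall>n\<ge>1. \<forall>t\<ge>0. ereal (?G n t) < ereal \<delta> \<longrightarrow> ereal (D n t) < ereal e"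
    proof (intro exI[of _ \<delta>] conjI allI impI)
      fix n :: nat and t :: real
      assume nt: "1 \<le> n" "0 \<le> t" and "ereal (?G n t) < ereal \<delta>"
      then have "(D n t)\<^sup>2 \<le> 1 - (1 - \<delta>\<^sup>2) ^ N" using \<delta> by (intro D_le) auto
      also have "\<dots> \<le> real N * \<delta>\<^sup>2"
        using Bernoulli_inequality[of "- \<delta>\<^sup>2" N] \<delta> by (simp add: power_le_one)
      also have "\<dots> < ((real N + 1) * \<delta>)\<^sup>2"
        using \<delta> by (simp add: power2_eq_square algebra_simps add_pos_nonneg)
      finally have "D n t < (real N + 1) * \<delta>"
        using \<delta> by (intro power_less_imp_less_base[of "D n t" 2]) auto
      with \<delta>_e show "ereal (D n t) < ereal e" by simp
    qed (use \<delta> in auto)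
  next
    fix c :: real assume "ereal c < 1"
    then show "\<exists>b. ereal b < 1 \<and> (\<forall>n\<ge>1. \<forall>t\<ge>0. ereal b < ereal (?G n t) \<longrightarrow> ereal c < ereal (D n t))"
      using G_le by (intro exI[of _ c]) (auto intro: less_le_trans)
  qed (use D in auto)
qed

section \<open>Cutoff for product chains\<close>

theorem theorem4p1:
  fixes k :: "nat \<Rightarrow> nat"
    and X :: "nat \<Rightarrow> nat \<Rightarrow> 'a set"
    and K :: "nat \<Rightarrow> nat \<Rightarrow> 'a \<Rightarrow> 'a \<Rightarrow> real"
    and \<pi> :: "nat \<Rightarrow> nat \<Rightarrow> 'a \<Rightarrow> real"
    and p :: "nat \<Rightarrow> nat \<Rightarrow> real"
    and \<mu> :: "nat \<Rightarrow> nat \<Rightarrow> 'a \<Rightarrow> real"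
    and S :: "nat \<Rightarrow> (nat \<Rightarrow> 'a) set"
    and KK :: "nat \<Rightarrow> (nat \<Rightarrow> 'a) \<Rightarrow> (nat \<Rightarrow> 'a) \<Rightarrow> real"
    and PP MM :: "nat \<Rightarrow> (nat \<Rightarrow> 'a) \<Rightarrow> real"
    and F :: "nat \<Rightarrow> real \<Rightarrow> ereal"
    and G :: "nat \<Rightarrow> real \<Rightarrow> real"
  defines "S \<equiv> \<lambda>n. Pi\<^sub>E {1..k n} (X n)"
    and "KK \<equiv> \<lambda>n. product_kernel {1..k n} (p n) (K n)"
    and "PP \<equiv> \<lambda>n. product_measure {1..k n} (\<pi> n)"
    and "MM \<equiv> \<lambda>n. product_measure {1..k n} (\<mu> n)"
    and "F \<equiv> F_fun k X K \<pi> p \<mu>"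
    and "G \<equiv> G_fun k X K \<pi> p \<mu>"
  assumes "\<And>n. 1 \<le> n \<Longrightarrow> 1 \<le> k n"
    and "\<And>n i. 1 \<le> n \<Longrightarrow> 1 \<le> i \<Longrightarrow> i \<le> k n \<Longrightarrow> irreducible_markov_chain (X n i) (K n i) (\<pi> n i)"
    and "\<And>n i. 1 \<le> n \<Longrightarrow> 1 \<le> i \<Longrightarrow> i \<le> k n \<Longrightarrow> 0 < p n i"
    and "\<And>n i. 1 \<le> n \<Longrightarrow> 1 \<le> i \<Longrightarrow> i \<le> k n \<Longrightarrow> probability_on (X n i) (\<mu> n i)"
  shows
    "(\<forall>t. (\<forall>n\<ge>1. 0 < t n) \<longrightarrow>
        (hellinger_cutoff S KK PP MM t \<longleftrightarrow>
          (\<forall>a>1. (\<lambda>n. F n (a * t n)) \<longlonglongrightarrow> 0) \<and>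
          (\<forall>a. 0 < a \<and> a < 1 \<longrightarrow> (\<lambda>n. F n (a * t n)) \<longlonglongrightarrow> \<infinity>))) \<and>
     (\<forall>t b.
        hellinger_window_cutoff S KK PP MM t b \<longleftrightarrow>
          (\<forall>n\<ge>1. 0 < t n) \<and> (\<forall>n\<ge>1. 0 < b n) \<and> b \<in> o(t) \<and>
          ((\<lambda>c. limsup (\<lambda>n. F n (t n + c * b n))) \<longlongrightarrow> 0) at_top \<and>
          ((\<lambda>c. liminf (\<lambda>n. F n (t n + c * b n))) \<longlongrightarrow> \<infinity>) at_bot) \<and>
     (bdd_above (k ` {1..}) \<longrightarrow>
        (\<forall>t. (\<forall>n\<ge>1. 0 < t n) \<longrightarrow>
           (hellinger_cutoff S KK PP MM t \<longleftrightarrow>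
             (\<forall>a>1. (\<lambda>n. G n (a * t n)) \<longlonglongrightarrow> 0) \<and>
             (\<forall>a. 0 < a \<and> a < 1 \<longrightarrow> (\<lambda>n. G n (a * t n)) \<longlonglongrightarrow> 1))) \<and>
        (\<forall>t b.
           hellinger_window_cutoff S KK PP MM t b \<longleftrightarrow>
             (\<forall>n\<ge>1. 0 < t n) \<and> (\<forall>n\<ge>1. 0 < b n) \<and> b \<in> o(t) \<and>
             ((\<lambda>c. limsup (\<lambda>n. ereal (G n (t n + c * b n)))) \<longlongrightarrow> 0) at_top \<and>
             ((\<lambda>c. liminf (\<lambda>n. ereal (G n (t n + c * b n)))) \<longlongrightarrow> 1) at_bot))"
proof -
  let ?D = "\<lambda>n s. hellinger_dist (S n) (KK n) (PP n) (MM n) s"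
  let ?d = "\<lambda>n s. coord_dist k X K \<pi> p \<mu> n s"
  let ?I = "\<lambda>n. {1..k n}"
  note k = assms(7) and chain = assms(8) and p = assms(9) and \<mu> = assms(10)
  have I: "finite (?I n)" "?I n \<noteq> {}" if "1 \<le> n" for n
    using k[OF that] by auto
  have K: "stochastic (X n i) (K n i)" and \<pi>: "probability_on (X n i) (\<pi> n i)"
    and p': "0 < p n i" and \<mu>': "probability_on (X n i) (\<mu> n i)" if "1 \<le> n" "i \<in> ?I n" for n i
    using chain[of n i] p[of n i] \<mu>[of n i] that
    by (auto simp: irreducible_markov_chain_def stationary_def)
  have d: "0 \<le> ?d n s i" "?d n s i \<le> 1" if n: "1 \<le> n" and s: "0 \<le> s" and i: "i \<in> ?I n" for n s i
  proof -
    have "0 < sum (p n) (?I n)" using I[OF n] p'[OF n] by (rule sum_pos)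
    then have time: "0 \<le> p n i * s / sum (p n) (?I n)"
      using p'[OF n i] s by simp
    show "0 \<le> ?d n s i" "?d n s i \<le> 1"
      unfolding coord_dist_def
      by (rule hellinger_dist_bounds[OF K[OF n i] \<pi>[OF n i] \<mu>'[OF n i] time])+
  qed
  have D: "0 \<le> ?D n s" "?D n s \<le> 1" if n: "1 \<le> n" and s: "0 \<le> s" for n s
    unfolding S_def KK_def PP_def MM_def
    by (intro hellinger_dist_bounds stochastic_product_kernel probability_on_product_measure I n s K p' \<pi> \<mu>';
        assumption)+
  have prod: "1 - (?D n s)\<^sup>2 = (\<Prod>i\<in>?I n. 1 - (?d n s i)\<^sup>2)" if n: "1 \<le> n" and s: "0 \<le> s" for n s
    unfolding S_def KK_def PP_def MM_def coord_dist_def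
    by (intro hellinger_dist_product I n s K p' \<pi> \<mu>'; assumption)
  have F: "F = (\<lambda>n s. square_ratio (?I n) (?d n s))"
    by (simp add: F_def F_fun_def square_ratio_def fun_eq_iff)
  have G: "G = (\<lambda>n s. Max (?d n s ` ?I n))"
    by (simp add: G_def G_fun_def fun_eq_iff)
  have FD: "limit_transfer (\<lambda>n s. ereal (?D n s)) 1 F \<infinity>" "limit_transfer F \<infinity> (\<lambda>n s. ereal (?D n s)) 1"
    unfolding F using square_ratio_transfer[where I = ?I and d = ?d and D = ?D, OF I d D prod] by blast+
  have GD: "limit_transfer (\<lambda>n s. ereal (?D n s)) 1 (\<lambda>n s. ereal (G n s)) 1"
    "limit_transfer (\<lambda>n s. ereal (G n s)) 1 (\<lambda>n s. ereal (?D n s)) 1" if bdd: "bdd_above (k ` {1..})"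
  proof -
    obtain N where "\<And>n. 1 \<le> n \<Longrightarrow> card (?I n) \<le> N"
      using bdd by (auto simp: bdd_above_def)
    then show "limit_transfer (\<lambda>n s. ereal (?D n s)) 1 (\<lambda>n s. ereal (G n s)) 1"
      "limit_transfer (\<lambda>n s. ereal (G n s)) 1 (\<lambda>n s. ereal (?D n s)) 1"
      unfolding G using Max_transfer[where I = ?I and d = ?d and D = ?D and N = N, OF I _ d D prod] by blast+
  qed
  have cutoff: "hellinger_cutoff S KK PP MM t \<longleftrightarrow> cutoff_limits f L t"
    if "limit_transfer (\<lambda>n s. ereal (?D n s)) 1 f L" "limit_transfer f L (\<lambda>n s. ereal (?D n s)) 1"
      "\<forall>n\<ge>1. 0 < t n" for f L t
    unfolding hellinger_cutoff_iff using cutoff_limits_transfer that by blast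
  have window: "hellinger_window_cutoff S KK PP MM t b \<longleftrightarrow>
      (\<forall>n\<ge>1. 0 < t n) \<and> (\<forall>n\<ge>1. 0 < b n) \<and> b \<in> o(t) \<and> window_limits f L t b"
    if tr: "limit_transfer (\<lambda>n s. ereal (?D n s)) 1 f L" "limit_transfer f L (\<lambda>n s. ereal (?D n s)) 1" for f L t b
  proof -
    have "window_limits (\<lambda>n s. ereal (?D n s)) 1 t b \<longleftrightarrow> window_limits f L t b"
      if "\<forall>n\<ge>1. 0 < t n" "\<forall>n\<ge>1. 0 < b n" "b \<in> o(t)"
      using window_limits_transfer[OF tr(1) eventually_window_nonneg[OF that]]
        window_limits_transfer[OF tr(2) eventually_window_nonneg[OF that]] by blast
    then show ?thesis unfolding hellinger_window_cutoff_iff by blast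
  qed
  show ?thesis
  proof (intro conjI allI impI)
    fix t :: "nat \<Rightarrow> real" assume "\<forall>n\<ge>1. 0 < t n"
    from cutoff[OF FD this]
    show "hellinger_cutoff S KK PP MM t \<longleftrightarrow>
        (\<forall>a>1. (\<lambda>n. F n (a * t n)) \<longlonglongrightarrow> 0) \<and>
        (\<forall>a. 0 < a \<and> a < 1 \<longrightarrow> (\<lambda>n. F n (a * t n)) \<longlonglongrightarrow> \<infinity>)"
      by (simp only: cutoff_limits_def)
  next
    fix t b :: "nat \<Rightarrow> real"
    from window[OF FD, of t b]
    show "hellinger_window_cutoff S KK PP MM t b \<longleftrightarrow>
        (\<forall>n\<ge>1. 0 < t n) \<and> (\<forall>n\<ge>1. 0 < b n) \<and> b \<in> o(t) \<and>
        ((\<lambda>c. limsup (\<lambda>n. F n (t n + c * b n))) \<longlongrightarrow> 0) at_top \<and>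
        ((\<lambda>c. liminf (\<lambda>n. F n (t n + c * b n))) \<longlongrightarrow> \<infinity>) at_bot"
      by (simp only: window_limits_def)
  next
    fix t :: "nat \<Rightarrow> real" assume bdd: "bdd_above (k ` {1..})" and t: "\<forall>n\<ge>1. 0 < t n"
    from cutoff[OF GD[OF bdd] t]
    show "hellinger_cutoff S KK PP MM t \<longleftrightarrow>
        (\<forall>a>1. (\<lambda>n. G n (a * t n)) \<longlonglongrightarrow> 0) \<and>
        (\<forall>a. 0 < a \<and> a < 1 \<longrightarrow> (\<lambda>n. G n (a * t n)) \<longlonglongrightarrow> 1)"
      by (simp only: cutoff_limits_def zero_ereal_def one_ereal_def lim_ereal)
  next
    fix t b :: "nat \<Rightarrow> real" assume bdd: "bdd_above (k ` {1..})"
    from window[OF GD[OF bdd], of t b]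
    show "hellinger_window_cutoff S KK PP MM t b \<longleftrightarrow>
        (\<forall>n\<ge>1. 0 < t n) \<and> (\<forall>n\<ge>1. 0 < b n) \<and> b \<in> o(t) \<and>
        ((\<lambda>c. limsup (\<lambda>n. ereal (G n (t n + c * b n)))) \<longlongrightarrow> 0) at_top \<and>
        ((\<lambda>c. liminf (\<lambda>n. ereal (G n (t n + c * b n)))) \<longlongrightarrow> 1) at_bot"
      by (simp only: window_limits_def)
  qed
qed

end
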